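(* Let $\Theta:(0,\infty)\to[1,\infty)$ be nondecreasing. (i) Let $(X_i,\star_i,d_i)$, $i\in\mathbb N$, $(X,\star,d)$ and $(X',\star',d')$ belong to $\mathcal M^\Theta_*$. If $(X,\star,d)$ and $(X',\star',d')$ are both forward $\Theta$-Gromov-Hausdorff limits of $(X_i,\star_i,d_i)_i$, then $(X,\star,d)$ is pointed isometric to $(X',\star',d')$. (ii) If $(X_i,\star_i,d_i)_i\subset\mathcal M^\Theta_*$ converges in the forward $\Theta$-Gromov-Hausdorff topology, then it converges to the same limit in the forward $\Theta'$-Gromov-Hausdorff topology for any nondecreasing function $\Theta'\ge\Theta$. (iii) If $(X_i,\star_i,d_i)_i\subset\mathcal M^\Theta_*$ converges to $(X,\star,d)\in\mathcal M^\Theta_*$ in the forward $\Theta$-Gromov-Hausdorff topology and satisfies $\mathrm{Diam}(X_i)\le D$ for all $i$, then $(X_i,d_i)_i$ converges to $(X,d)$ in the $\theta$-Gromov-Hausdorff topology for any $\theta\ge\Theta(D)$. (iv) If $\theta\ge 1$ and $(X_i,d_i)_i\subset\mathcal M^\theta$ converges to $(X,d)\in\mathcal M^\theta$ in the $\theta$-Gromov-Hausdorff topology, then there exist points $\star_i\in X_i$ and $\star\in X$ such that $(X_i,\star_i,d_i)_i$ converges to $(X,\star,d)$ in the forward $\Theta$-Gromov-Hausdorff topology for any nondecreasing function $\Theta\ge\theta$.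
   Context: An irreversible metric on $X$ is $d:X\times X\to[0,\infty)$ with $d(x,y)=0$ iff $x=y$ and $d(x,z)\le d(x,y)+d(y,z)$ (no symmetry). $B^+_x(r)=\{y:d(x,y)<r\}$ are the forward balls, which generate the topology; $\overline{B^+_x(r)}$ denotes the closed forward ball $\{y:d(x,y)\le r\}$. $\mathrm{Diam}(X)=\sup_{x,y}d(x,y)$. For $A\subset X$, $\lambda_d(A)=\inf\{\lambda\ge1:d(x,y)\le\lambda\,d(y,x)\ \forall x,y\in A\}$. $(X,d)$ is a $\theta$-metric space if $\lambda_d(X)\le\theta$; $\mathcal M^\theta$ is the collection of compact $\theta$-metric spaces. $(X,\star,d)$ is a pointed forward $\Theta$-metric space if $\lambda_d(\overline{B^+_\star(r)})\le\Theta(r)$ for every $r>0$. Forward boundedly compact means every closed forward ball is compact. $\mathcal M^\Theta_*$ is the collection of forward boundedly compact pointed forward $\Theta$-metric spaces. A pointed isometry is a distance-preserving homeomorphism mapping base point to base point. For $A\subset X$, $A^\epsilon=\{x:d(A,x)<\epsilon\}$ with $d(A,x)=\inf_{a\in A}d(a,x)$; $\mathrm{dis} f=\sup_{x,x'}|d_Y(f(x),f(x'))-d_X(x,x')|$. Forward $\Theta$-Gromov-Hausdorff convergence: $(X_i,\star_i,d_i)_i\subset\mathcal M^\Theta_*$ converges to $(X,\star,d)\in\mathcal M^\Theta_*$ (its forward $\Theta$-Gromov-Hausdorff limit) if for every $r>0$ and $\epsilon>0$ there is $N$ such that for all $i>N$ there is a (not necessarily continuous) map $f_i:\overline{B^+_{\star_i}(r)}\to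 X$ with $f_i(\star_i)=\star$, $\mathrm{dis} f_i\le\epsilon$, $\overline{B^+_\star(r-\epsilon)}\subset[f_i(\overline{B^+_{\star_i}(r)})]^\epsilon$. $\theta$-Gromov-Hausdorff convergence: for $(X_1,d_1),(X_2,d_2)\in\mathcal M^\theta$, a $\theta$-admissible metric is an irreversible metric $d$ on $X_1\sqcup X_2$ with $\lambda_d(X_1\sqcup X_2)\le\theta$ and $d|_{X_i}=d_i$; $d_H(A,B)=\inf\{\epsilon>0:A\subset B^\epsilon,B\subset A^\epsilon\}$; $d^\theta_{GH}$ is the infimum of $d_H(X_1,X_2)$ over $\theta$-admissible metrics. $(X_i,d_i)\to(X,d)$ in the $\theta$-Gromov-Hausdorff topology if $d^\theta_{GH}(X_i,X)\to0$ (all spaces in $\mathcal M^\theta$). *)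

theory Defs
  imports "HOL-Analysis.Analysis"
begin

text \<open>
  A space is a carrier set \<open>X\<close> with a distance function on the ambient type, of which only the
  values on \<open>X\<close> matter.  Infima and suprema are taken in \<^typ>\<open>ereal\<close>, so that the
  infimum of an empty set of candidates is \<open>\<infinity>\<close>.
\<close>

definition irreversible_metric :: "'a set \<Rightarrow> ('a \<Rightarrow> 'a \<Rightarrow> real) \<Rightarrow> bool" where
  "irreversible_metric X d \<longleftrightarrow>
     (\<forall>x\<in>X. \<forall>y\<in>X. 0 \<le> d x y) \<and>
     (\<forall>x\<in>X. \<forall>y\<in>X. d x y = 0 \<longleftrightarrow> x = y) \<and>
     (\<forall>x\<in>X. \<forall>y\<in>X. \<forall>z\<in>X. d x z \<le> d x y + d y z)"

definition fwd_ball :: "'a set \<Rightarrow> ('a \<Rightarrow> 'a \<Rightarrow> real) \<Rightarrow> 'a \<Rightarrow> real \<Rightarrow> 'a set" where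
  "fwd_ball X d x r = {y \<in> X. d x y < r}"

definition fwd_cball :: "'a set \<Rightarrow> ('a \<Rightarrow> 'a \<Rightarrow> real) \<Rightarrow> 'a \<Rightarrow> real \<Rightarrow> 'a set" where
  "fwd_cball X d x r = {y \<in> X. d x y \<le> r}"

definition fwd_topology :: "'a set \<Rightarrow> ('a \<Rightarrow> 'a \<Rightarrow> real) \<Rightarrow> 'a topology" where
  "fwd_topology X d = topology_generated_by {fwd_ball X d x r | x r. x \<in> X \<and> 0 < r}"

definition Diam :: "'a set \<Rightarrow> ('a \<Rightarrow> 'a \<Rightarrow> real) \<Rightarrow> ereal" where
  "Diam X d = (SUP x\<in>X. SUP y\<in>X. ereal (d x y))"

definition reversibility :: "('a \<Rightarrow> 'a \<Rightarrow> real) \<Rightarrow> 'a set \<Rightarrow> ereal" where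
  "reversibility d A = Inf {ereal l | l. 1 \<le> l \<and> (\<forall>x\<in>A. \<forall>y\<in>A. d x y \<le> l * d y x)}"

text \<open>
  As usual, metric spaces are nonempty; for pointed spaces this is implied by the base point.
\<close>

definition compact_theta_space :: "real \<Rightarrow> 'a set \<Rightarrow> ('a \<Rightarrow> 'a \<Rightarrow> real) \<Rightarrow> bool" where
  "compact_theta_space \<theta> X d \<longleftrightarrow>
     X \<noteq> {} \<and> irreversible_metric X d \<and> reversibility d X \<le> ereal \<theta> \<and>
     compact_space (fwd_topology X d)"

definition pointed_fwd_Theta_space ::
  "(real \<Rightarrow> real) \<Rightarrow> 'a set \<Rightarrow> 'a \<Rightarrow> ('a \<Rightarrow> 'a \<Rightarrow> real) \<Rightarrow> bool" where
  "pointed_fwd_Theta_space \<Theta> X p d \<longleftrightarrow>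
     irreversible_metric X d \<and> p \<in> X \<and>
     (\<forall>r>0. reversibility d (fwd_cball X d p r) \<le> ereal (\<Theta> r))"

definition fwd_boundedly_compact :: "'a set \<Rightarrow> ('a \<Rightarrow> 'a \<Rightarrow> real) \<Rightarrow> bool" where
  "fwd_boundedly_compact X d \<longleftrightarrow>
     (\<forall>x\<in>X. \<forall>r>0. compactin (fwd_topology X d) (fwd_cball X d x r))"

definition pointed_Theta_class ::
  "(real \<Rightarrow> real) \<Rightarrow> 'a set \<Rightarrow> 'a \<Rightarrow> ('a \<Rightarrow> 'a \<Rightarrow> real) \<Rightarrow> bool" where
  "pointed_Theta_class \<Theta> X p d \<longleftrightarrow>
     pointed_fwd_Theta_space \<Theta> X p d \<and> fwd_boundedly_compact X d"

text \<open>Only the values of \<open>\<Theta>\<close> on the positive reals matter.\<close>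

definition reversibility_bound :: "(real \<Rightarrow> real) \<Rightarrow> bool" where
  "reversibility_bound \<Theta> \<longleftrightarrow> (\<forall>r>0. 1 \<le> \<Theta> r) \<and> mono_on {0<..} \<Theta>"

definition pointed_isometric ::
  "'a set \<Rightarrow> 'a \<Rightarrow> ('a \<Rightarrow> 'a \<Rightarrow> real) \<Rightarrow> 'b set \<Rightarrow> 'b \<Rightarrow> ('b \<Rightarrow> 'b \<Rightarrow> real) \<Rightarrow> bool" where
  "pointed_isometric X p d X' p' d' \<longleftrightarrow>
     (\<exists>h. homeomorphic_map (fwd_topology X d) (fwd_topology X' d') h \<and>
          (\<forall>x\<in>X. \<forall>y\<in>X. d' (h x) (h y) = d x y) \<and> h p = p')"

definition set_dist :: "('a \<Rightarrow> 'a \<Rightarrow> real) \<Rightarrow> 'a set \<Rightarrow> 'a \<Rightarrow> ereal" where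
  "set_dist d A x = (INF a\<in>A. ereal (d a x))"

definition fwd_nbhd :: "'a set \<Rightarrow> ('a \<Rightarrow> 'a \<Rightarrow> real) \<Rightarrow> 'a set \<Rightarrow> real \<Rightarrow> 'a set" where
  "fwd_nbhd X d A \<epsilon> = {x \<in> X. set_dist d A x < ereal \<epsilon>}"

definition distortion ::
  "'a set \<Rightarrow> ('a \<Rightarrow> 'a \<Rightarrow> real) \<Rightarrow> ('b \<Rightarrow> 'b \<Rightarrow> real) \<Rightarrow> ('a \<Rightarrow> 'b) \<Rightarrow> ereal" where
  "distortion A dX dY f = (SUP x\<in>A. SUP x'\<in>A. ereal \<bar>dY (f x) (f x') - dX x x'\<bar>)"

definition fwd_GH_converges ::
  "(real \<Rightarrow> real) \<Rightarrow> (nat \<Rightarrow> 'a set) \<Rightarrow> (nat \<Rightarrow> 'a) \<Rightarrow> (nat \<Rightarrow> 'a \<Rightarrow> 'a \<Rightarrow> real)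
     \<Rightarrow> 'b set \<Rightarrow> 'b \<Rightarrow> ('b \<Rightarrow> 'b \<Rightarrow> real) \<Rightarrow> bool" where
  "fwd_GH_converges \<Theta> Xs ps ds X p d \<longleftrightarrow>
     (\<forall>i. pointed_Theta_class \<Theta> (Xs i) (ps i) (ds i)) \<and>
     pointed_Theta_class \<Theta> X p d \<and>
     (\<forall>r>0. \<forall>\<epsilon>>0. \<exists>N. \<forall>i>N. \<exists>f \<in> fwd_cball (Xs i) (ds i) (ps i) r \<rightarrow> X.
        f (ps i) = p \<and>
        distortion (fwd_cball (Xs i) (ds i) (ps i) r) (ds i) d f \<le> ereal \<epsilon> \<and>
        fwd_cball X d p (r - \<epsilon>) \<subseteq> fwd_nbhd X d (f ` fwd_cball (Xs i) (ds i) (ps i) r) \<epsilon>)"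

definition hausdorff_distance ::
  "'a set \<Rightarrow> ('a \<Rightarrow> 'a \<Rightarrow> real) \<Rightarrow> 'a set \<Rightarrow> 'a set \<Rightarrow> ereal" where
  "hausdorff_distance Z d A B =
     Inf {ereal \<epsilon> | \<epsilon>. 0 < \<epsilon> \<and> A \<subseteq> fwd_nbhd Z d B \<epsilon> \<and> B \<subseteq> fwd_nbhd Z d A \<epsilon>}"

definition theta_admissible ::
  "real \<Rightarrow> 'a set \<Rightarrow> ('a \<Rightarrow> 'a \<Rightarrow> real) \<Rightarrow> 'b set \<Rightarrow> ('b \<Rightarrow> 'b \<Rightarrow> real)
     \<Rightarrow> ('a + 'b \<Rightarrow> 'a + 'b \<Rightarrow> real) \<Rightarrow> bool" where
  "theta_admissible \<theta> X1 d1 X2 d2 d \<longleftrightarrow>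
     irreversible_metric (X1 <+> X2) d \<and> reversibility d (X1 <+> X2) \<le> ereal \<theta> \<and>
     (\<forall>x\<in>X1. \<forall>y\<in>X1. d (Inl x) (Inl y) = d1 x y) \<and>
     (\<forall>x\<in>X2. \<forall>y\<in>X2. d (Inr x) (Inr y) = d2 x y)"

definition theta_GH_distance ::
  "real \<Rightarrow> 'a set \<Rightarrow> ('a \<Rightarrow> 'a \<Rightarrow> real) \<Rightarrow> 'b set \<Rightarrow> ('b \<Rightarrow> 'b \<Rightarrow> real) \<Rightarrow> ereal" where
  "theta_GH_distance \<theta> X1 d1 X2 d2 =
     Inf {hausdorff_distance (X1 <+> X2) d (Inl ` X1) (Inr ` X2) | d.
            theta_admissible \<theta> X1 d1 X2 d2 d}"

definition theta_GH_converges ::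
  "real \<Rightarrow> (nat \<Rightarrow> 'a set) \<Rightarrow> (nat \<Rightarrow> 'a \<Rightarrow> 'a \<Rightarrow> real) \<Rightarrow> 'b set \<Rightarrow> ('b \<Rightarrow> 'b \<Rightarrow> real) \<Rightarrow> bool" where
  "theta_GH_converges \<theta> Xs ds X d \<longleftrightarrow>
     (\<forall>i. compact_theta_space \<theta> (Xs i) (ds i)) \<and> compact_theta_space \<theta> X d \<and>
     (\<lambda>i. theta_GH_distance \<theta> (Xs i) (ds i) X d) \<longlonglongrightarrow> 0"

end

theory Submission
  imports Defs
begin

text \<open>
  Uniqueness of the limit: composing approximations through a common \<open>X\<^sub>i\<close> gives, for every finite
  set of points, almost isometries \<open>h\<close> and \<open>k\<close> between the two limits that are almost inverse to
  each other.  Tychonoff's theorem on the product of closed forward balls replaces the diagonal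
  argument and turns them into an isometry.

  For spaces of diameter at most \<open>D\<close>, an approximation \<open>f\<close> glues \<open>X\<^sub>i\<close> to \<open>X\<close> by placing
  \<open>a\<close> and \<open>f a\<close> at distance \<open>c\<close> in both directions, where \<open>2 * c\<close> bounds the distortion; the
  glued distance is \<open>\<theta>\<close>-reversible because \<open>c \<le> \<theta> * c\<close>.  Conversely, an admissible metric with
  small Hausdorff distance gives an approximation by sending each point to a nearby one.
\<close>

section \<open>Irreversible metrics and their topology\<close>

lemma irreversible_metricD:
  assumes "irreversible_metric X d"
  shows "\<And>x y. x \<in> X \<Longrightarrow> y \<in> X \<Longrightarrow> 0 \<le> d x y"
    and "\<And>x y. x \<in> X \<Longrightarrow> y \<in> X \<Longrightarrow> d x y = 0 \<longleftrightarrow> x = y"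
    and "\<And>x. x \<in> X \<Longrightarrow> d x x = 0"
    and "\<And>x y z. x \<in> X \<Longrightarrow> y \<in> X \<Longrightarrow> z \<in> X \<Longrightarrow> d x z \<le> d x y + d y z"
  using assms unfolding irreversible_metric_def by blast+

section \<open>The reversibility constant as an infimum\<close>

lemma reversibility_ge_1:
  assumes "reversibility d A \<le> ereal \<theta>"
  shows "1 \<le> \<theta>"
proof -
  have "1 \<le> reversibility d A"
    unfolding reversibility_def by (rule Inf_greatest) auto
  then show ?thesis
    using assms by (metis ereal_less_eq(3) one_ereal_def order_trans)
qed

text \<open>The infimum in \<open>reversibility\<close> is attained in this sense: if the inequality
  failed for \<open>\<theta>\<close>, it would also fail for some slightly larger factor, yet every
  number above the infimum is an admissible factor.\<close>

lemma reversibilityD: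
  assumes "reversibility d A \<le> ereal \<theta>" "x \<in> A" "y \<in> A" "0 \<le> d y x"
  shows "d x y \<le> \<theta> * d y x"
proof (rule ccontr)
  assume gap: "\<not> d x y \<le> \<theta> * d y x"
  \<comment> \<open>The summand 1 in the denominator covers the case \<open>d y x = 0\<close> and
    makes \<open>e * d y x\<close> strictly smaller than the gap.\<close>
  define e where "e = (d x y - \<theta> * d y x) / (d y x + 1)"
  have e: "0 < e" "e * d y x < d x y - \<theta> * d y x"
    using gap assms(4) by (auto simp: e_def field_simps add_nonneg_pos)
  have "reversibility d A < ereal (\<theta> + e)"
    using assms(1) e(1) by (metis ereal_less(2) ereal_less_eq(3) less_add_same_cancel1 less_le_not_le order_le_less_trans not_le)
  then obtain l where "l < \<theta> + e" "d x y \<le> l * d y x"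
    unfolding reversibility_def Inf_less_iff using assms(2,3) by auto
  moreover have "l * d y x \<le> (\<theta> + e) * d y x"
    using \<open>l < \<theta> + e\<close> assms(4) by (intro mult_right_mono) auto
  ultimately show False
    using e(2) by (simp add: algebra_simps)
qed

lemma reversibilityI:
  assumes "1 \<le> \<theta>" "\<And>x y. x \<in> A \<Longrightarrow> y \<in> A \<Longrightarrow> d x y \<le> \<theta> * d y x"
  shows "reversibility d A \<le> ereal \<theta>"
  unfolding reversibility_def by (rule Inf_lower) (use assms in auto)

lemma reversibility_mono:
  assumes "A \<subseteq> B"
  shows "reversibility d A \<le> reversibility d B"
proof -
  have "\<forall>x\<in>A. \<forall>y\<in>A. d x y \<le> l * d y x" if "\<forall>x\<in>B. \<forall>y\<in>B. d x y \<le> l * d y x" for l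
    using that assms by (simp add: subset_iff)
  then show ?thesis
    unfolding reversibility_def by (intro Inf_superset_mono) auto
qed

lemma distortion_le_iff:
  "distortion A dX dY f \<le> ereal e \<longleftrightarrow> (\<forall>x\<in>A. \<forall>y\<in>A. \<bar>dY (f x) (f y) - dX x y\<bar> \<le> e)"
  unfolding distortion_def by (simp add: SUP_le_iff)

lemma mem_fwd_nbhd_iff:
  "x \<in> fwd_nbhd X d A e \<longleftrightarrow> x \<in> X \<and> (\<exists>a\<in>A. d a x < e)"
  unfolding fwd_nbhd_def set_dist_def by (simp add: INF_less_iff)

lemma mem_fwd_cball_iff: "y \<in> fwd_cball X d x r \<longleftrightarrow> y \<in> X \<and> d x y \<le> r"
  unfolding fwd_cball_def by simp

section \<open>The topology generated by forward balls\<close>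

lemma topspace_fwd_topology:
  assumes "irreversible_metric X d"
  shows "topspace (fwd_topology X d) = X"
proof -
  have "x \<in> fwd_ball X d x 1" if "x \<in> X" for x
    using irreversible_metricD(3)[OF assms that] that by (simp add: fwd_ball_def)
  then have "\<exists>U. (\<exists>y r. U = fwd_ball X d y r \<and> y \<in> X \<and> 0 < r) \<and> x \<in> U" if "x \<in> X" for x
    using that zero_less_one by blast
  moreover have "fwd_ball X d x r \<subseteq> X" for x r
    by (auto simp: fwd_ball_def)
  ultimately show ?thesis
    unfolding fwd_topology_def topology_generated_by_topspace by (simp add: set_eq_iff) blast
qed

lemma openin_fwd_ball:
  assumes "x \<in> X" "0 < r"
  shows "openin (fwd_topology X d) (fwd_ball X d x r)"
  unfolding fwd_topology_def using assms by (intro topology_generated_by_Basis) auto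

text \<open>By surjectivity every basic ball is centred at some \<open>h x\<close>, and its preimage
  is the ball of the same radius about \<open>x\<close>.\<close>

lemma isometry_continuous_map:
  assumes X: "irreversible_metric X d" and Y: "irreversible_metric Y e"
    and h: "h ` X = Y" and iso: "\<And>x y. x \<in> X \<Longrightarrow> y \<in> X \<Longrightarrow> e (h x) (h y) = d x y"
  shows "continuous_map (fwd_topology X d) (fwd_topology Y e) h"
  unfolding fwd_topology_def[of Y]
proof (rule continuous_on_generated_topo)
  fix U assume "U \<in> {fwd_ball Y e x r |x r. x \<in> Y \<and> 0 < r}"
  then obtain x r where x: "x \<in> X" "0 < r" "U = fwd_ball Y e (h x) r"
    using h by blast
  have hY: "h y \<in> Y" if "y \<in> X" for y
    using h that by blast
  have "h -` U \<inter> X = fwd_ball X d x r"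
    unfolding x(3) fwd_ball_def by (auto simp: iso[OF x(1)] intro: hY)
  then show "openin (fwd_topology X d) (h -` U \<inter> topspace (fwd_topology X d))"
    using x openin_fwd_ball topspace_fwd_topology[OF X] by metis
next
  show "h ` topspace (fwd_topology X d) \<subseteq> \<Union> {fwd_ball Y e x r |x r. x \<in> Y \<and> 0 < r}"
    using topspace_fwd_topology[OF X] topspace_fwd_topology[OF Y] h
    unfolding fwd_topology_def[of Y] topology_generated_by_topspace by simp
qed

lemma isometry_homeomorphic_map:
  assumes X: "irreversible_metric X d" and Y: "irreversible_metric Y e"
    and h: "h ` X = Y" and iso: "\<And>x y. x \<in> X \<Longrightarrow> y \<in> X \<Longrightarrow> e (h x) (h y) = d x y"
  shows "homeomorphic_map (fwd_topology X d) (fwd_topology Y e) h"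
proof -
  have inj: "inj_on h X"
  proof (rule inj_onI)
    fix x y assume "x \<in> X" "y \<in> X" "h x = h y"
    then show "x = y"
      using iso[of x y] irreversible_metricD(2)[OF X] irreversible_metricD(3)[OF Y, of "h y"] h by auto
  qed
  have "continuous_map (fwd_topology Y e) (fwd_topology X d) (inv_into X h)"
    using inj h iso by (intro isometry_continuous_map X Y) auto
  then have "homeomorphic_maps (fwd_topology X d) (fwd_topology Y e) h (inv_into X h)"
    unfolding homeomorphic_maps_def using isometry_continuous_map[OF X Y h iso] inj h
    by (auto simp: topspace_fwd_topology[OF X] topspace_fwd_topology[OF Y] f_inv_into_f)
  then show ?thesis
    using homeomorphic_map_maps by blast
qed

lemma pointed_Theta_classD:
  assumes "pointed_Theta_class \<Theta> X p d"
  shows "irreversible_metric X d" "p \<in> X"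
    and "\<And>r. 0 < r \<Longrightarrow> reversibility d (fwd_cball X d p r) \<le> ereal (\<Theta> r)"
    and "\<And>x r. x \<in> X \<Longrightarrow> 0 < r \<Longrightarrow> compactin (fwd_topology X d) (fwd_cball X d x r)"
  using assms
  unfolding pointed_Theta_class_def pointed_fwd_Theta_space_def fwd_boundedly_compact_def by auto

text \<open>Reversal of distances is controlled only in balls about the base point, so each later
  use first has to exhibit a radius \<open>r\<close> that captures both points.\<close>

lemma pointed_Theta_class_reverse:
  assumes "pointed_Theta_class \<Theta> X p d" "x \<in> X" "y \<in> X" "d p x \<le> r" "d p y \<le> r" "0 < r"
  shows "d x y \<le> \<Theta> r * d y x"
  using assms pointed_Theta_classD(1)[OF assms(1)]
  by (intro reversibilityD[OF pointed_Theta_classD(3)[OF assms(1,6)]])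
    (auto simp: mem_fwd_cball_iff irreversible_metricD)

section \<open>Continuity of the distance function\<close>

text \<open>Forward balls make only the distances away from their centres small, while moving both
  arguments of \<open>d\<close> needs both directions. The backward ones are bounded through
  \<open>\<Theta>\<close> on a ball about \<open>p\<close>. Continuity later makes conditions on
  distances closed.\<close>

lemma continuous_map_dist:
  assumes C: "pointed_Theta_class \<Theta> X p d"
  shows "continuous_map (prod_topology (fwd_topology X d) (fwd_topology X d)) euclideanreal
           (\<lambda>z. d (fst z) (snd z))"
proof -
  note M = irreversible_metricD[OF pointed_Theta_classD(1)[OF C]]
  note top = topspace_fwd_topology[OF pointed_Theta_classD(1)[OF C]]
  let ?T = "fwd_topology X d"
  define P where "P = prod_topology ?T ?T"
  have tP: "topspace P = X \<times> X"
    by (simp add: P_def top)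
  have near: "\<exists>W. openin P W \<and> z \<in> W \<and> (\<forall>w\<in>W. \<bar>d (fst w) (snd w) - d (fst z) (snd z)\<bar> < e)"
    if z: "z \<in> X \<times> X" and e: "0 < e" for z e
  proof -
    obtain x y where xy: "z = (x, y)" "x \<in> X" "y \<in> X"
      using z by auto
    \<comment> \<open>The extra 1 keeps every point reached from \<open>x\<close> or
      \<open>y\<close> by a step of length at most 1 inside the ball of radius
      \<open>r\<close>.\<close>
    define r where "r = d p x + d p y + 1"
    have nn: "0 \<le> d p x" "0 \<le> d p y"
      using M(1) pointed_Theta_classD(2)[OF C] xy by auto
    have r: "0 < r" "d p x + 1 \<le> r" "d p y + 1 \<le> r"
      using nn by (auto simp: r_def)
    have L: "1 \<le> \<Theta> r"
      using reversibility_ge_1[OF pointed_Theta_classD(3)[OF C r(1)]] .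
    \<comment> \<open>Moving one argument within its ball then costs at most \<open>e / 3\<close> in
      either direction, so moving both stays strictly below \<open>e\<close>.\<close>
    define s where "s = min 1 (e / (3 * \<Theta> r))"
    have s: "0 < s" "s \<le> 1" "\<Theta> r * s \<le> e / 3"
      using e L by (auto simp: s_def min_def field_simps)
    have close: "d v u \<le> e / 3" "d u v \<le> e / 3" if "u \<in> X" "d p u + 1 \<le> r" "v \<in> fwd_ball X d u s" for u v
    proof -
      have v: "v \<in> X" "d u v < s"
        using that by (auto simp: fwd_ball_def)
      have "d p v \<le> r"
        using M(4)[of p u v] pointed_Theta_classD(2)[OF C] that v s(2) by auto
      then have "d v u \<le> \<Theta> r * d u v"
        using that v r by (intro pointed_Theta_class_reverse[OF C]) auto
      also have "\<dots> \<le> \<Theta> r * s"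
        using L v by (intro mult_left_mono) auto
      finally show "d v u \<le> e / 3" using s by simp
      have "1 * d u v \<le> \<Theta> r * s"
        using L v M(1)[of u v] that by (intro mult_mono) auto
      then show "d u v \<le> e / 3" using s by simp
    qed
    have "\<bar>d (fst w) (snd w) - d x y\<bar> < e" if w: "w \<in> fwd_ball X d x s \<times> fwd_ball X d y s" for w
    proof -
      obtain u v where uv: "w = (u, v)" "u \<in> fwd_ball X d x s" "v \<in> fwd_ball X d y s"
        using w by auto
      then have "u \<in> X" "v \<in> X" by (auto simp: fwd_ball_def)
      then have "d u v \<le> d u x + (d x y + d y v)" "d x y \<le> d x u + (d u v + d v y)"
        using M(4)[of u x v] M(4)[of x y v] M(4)[of x u y] M(4)[of u v y] xy by auto
      then show ?thesis
        using close[OF xy(2) r(2) uv(2)] close[OF xy(3) r(3) uv(3)] e uv by (simp add: abs_less_iff)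
    qed
    moreover have "openin P (fwd_ball X d x s \<times> fwd_ball X d y s)"
      using openin_fwd_ball[OF xy(2) s(1)] openin_fwd_ball[OF xy(3) s(1)]
      by (simp add: P_def openin_prod_Times_iff)
    moreover have "z \<in> fwd_ball X d x s \<times> fwd_ball X d y s"
      using xy s M(3) by (simp add: fwd_ball_def)
    ultimately show ?thesis
      using xy by (intro exI[of _ "fwd_ball X d x s \<times> fwd_ball X d y s"]) auto
  qed
  have "continuous_map P euclideanreal (\<lambda>z. d (fst z) (snd z))"
    unfolding continuous_map_def
  proof (intro conjI allI impI)
    fix U :: "real set" assume "openin euclideanreal U"
    then have U: "open U" by simp
    show "openin P {z \<in> topspace P. d (fst z) (snd z) \<in> U}"
    proof (subst openin_subopen, safe)
      fix a b assume ab: "(a, b) \<in> topspace P" "d (fst (a, b)) (snd (a, b)) \<in> U"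
      then obtain e where e: "0 < e" "\<And>t. \<bar>t - d a b\<bar> < e \<Longrightarrow> t \<in> U"
        using U by (auto simp: open_real)
      obtain W where "openin P W" "(a, b) \<in> W" "\<forall>w\<in>W. \<bar>d (fst w) (snd w) - d a b\<bar> < e"
        using near[of "(a, b)" e] ab e tP by auto
      then show "\<exists>T. openin P T \<and> (a, b) \<in> T \<and> T \<subseteq> {z \<in> topspace P. d (fst z) (snd z) \<in> U}"
        using e(2) openin_subset by (intro exI[of _ W]) fastforce
    qed
  qed auto
  then show ?thesis by (simp add: P_def)
qed

lemma continuous_map_dist_comp:
  assumes "pointed_Theta_class \<Theta> X p d"
    "continuous_map T (fwd_topology X d) f" "continuous_map T (fwd_topology X d) g"
  shows "continuous_map T euclideanreal (\<lambda>t. d (f t) (g t))"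
  using continuous_map_compose[OF continuous_map_pairedI[OF assms(2,3)] continuous_map_dist[OF assms(1)]]
  by (simp add: o_def)

section \<open>Forward Gromov-Hausdorff approximations\<close>

lemma fwd_GH_convergesD:
  assumes "fwd_GH_converges \<Theta> Xs ps ds X p d"
  shows "\<And>i. pointed_Theta_class \<Theta> (Xs i) (ps i) (ds i)" "pointed_Theta_class \<Theta> X p d"
  using assms unfolding fwd_GH_converges_def by auto

lemma fwd_GH_converges_approximations:
  assumes "fwd_GH_converges \<Theta> Xs ps ds X p d" "0 < r" "0 < \<epsilon>"
  shows "\<exists>N. \<forall>i>N. \<exists>f \<in> fwd_cball (Xs i) (ds i) (ps i) r \<rightarrow> X.
      f (ps i) = p \<and>
      distortion (fwd_cball (Xs i) (ds i) (ps i) r) (ds i) d f \<le> ereal \<epsilon> \<and>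
      fwd_cball X d p (r - \<epsilon>) \<subseteq> fwd_nbhd X d (f ` fwd_cball (Xs i) (ds i) (ps i) r) \<epsilon>"
  using assms(1)[unfolded fwd_GH_converges_def, THEN conjunct2, THEN conjunct2,
      THEN spec, THEN mp, OF assms(2), THEN spec, THEN mp, OF assms(3)] .

text \<open>Points of \<open>A\<close> are approximated in both directions, whereas the
  neighbourhoods in the definition of convergence are one-sided.\<close>

definition almost_isometry ::
  "real \<Rightarrow> 'a set \<Rightarrow> ('a \<Rightarrow> 'a \<Rightarrow> real) \<Rightarrow> 'b set \<Rightarrow> ('b \<Rightarrow> 'b \<Rightarrow> real) \<Rightarrow> ('a \<Rightarrow> 'b) \<Rightarrow> 'b set \<Rightarrow> bool"
where
  "almost_isometry \<delta> B dB X d f A \<longleftrightarrow>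
     f \<in> B \<rightarrow> X \<and>
     (\<forall>a\<in>B. \<forall>b\<in>B. \<bar>d (f a) (f b) - dB a b\<bar> \<le> \<delta>) \<and>
     (\<forall>x\<in>A. \<exists>a\<in>B. d (f a) x < \<delta> \<and> d x (f a) < \<delta>)"

text \<open>The extra unit of radius in the domain absorbs the loss \<open>r - \<epsilon>\<close> in
  the definition of convergence. Closeness in the opposite direction costs a factor
  \<open>\<Theta> (R + 2)\<close>, paid in advance by a smaller tolerance.\<close>

lemma fwd_GH_approximation:
  assumes conv: "fwd_GH_converges \<Theta> Xs ps ds X p d" and R: "0 < R" and \<delta>: "0 < \<delta>"
  shows "\<exists>N. \<forall>i>N. \<exists>f. f (ps i) = p \<and>
    almost_isometry \<delta> (fwd_cball (Xs i) (ds i) (ps i) (R + 1)) (ds i) X d f (fwd_cball X d p R)"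
proof -
  note C = fwd_GH_convergesD[OF conv]
  note M = irreversible_metricD[OF pointed_Theta_classD(1)[OF C(2)]]
  have p: "p \<in> X" using pointed_Theta_classD(2)[OF C(2)] .
  have R2: "0 < R + 2" using R by simp
  have L: "1 \<le> \<Theta> (R + 2)"
    using reversibility_ge_1[OF pointed_Theta_classD(3)[OF C(2) R2]] .
  define e where "e = min 1 (\<delta> / \<Theta> (R + 2))"
  have e: "0 < e" "e \<le> 1" "\<Theta> (R + 2) * e \<le> \<delta>"
    using \<delta> L by (auto simp: e_def min_def field_simps)
  have "1 * e \<le> \<Theta> (R + 2) * e"
    using e L by (intro mult_right_mono) auto
  then have e\<delta>: "e \<le> \<delta>" using e(3) by linarith
  obtain N where N: "\<forall>i>N. \<exists>f \<in> fwd_cball (Xs i) (ds i) (ps i) (R + 1) \<rightarrow> X. f (ps i) = p \<and>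
        distortion (fwd_cball (Xs i) (ds i) (ps i) (R + 1)) (ds i) d f \<le> ereal e \<and>
        fwd_cball X d p (R + 1 - e) \<subseteq> fwd_nbhd X d (f ` fwd_cball (Xs i) (ds i) (ps i) (R + 1)) e"
    using fwd_GH_converges_approximations[OF conv _ e(1), of "R + 1"] R by auto
  show ?thesis
  proof (intro exI[of _ N] allI impI)
    fix i assume "N < i"
    let ?B = "fwd_cball (Xs i) (ds i) (ps i) (R + 1)"
    obtain f where f: "f \<in> ?B \<rightarrow> X" "f (ps i) = p" "distortion ?B (ds i) d f \<le> ereal e"
        "fwd_cball X d p (R + 1 - e) \<subseteq> fwd_nbhd X d (f ` ?B) e"
      using N \<open>N < i\<close> by blast
    have dis: "\<bar>d (f a) (f b) - ds i a b\<bar> \<le> e" if "a \<in> ?B" "b \<in> ?B" for a b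
      using f(3) that by (simp add: distortion_le_iff)
    have Mi: "irreversible_metric (Xs i) (ds i)" "ps i \<in> Xs i"
      using pointed_Theta_classD[OF C(1)[of i]] by auto
    have pi: "ps i \<in> ?B"
      using Mi irreversible_metricD(3)[OF Mi(1) Mi(2)] R by (simp add: mem_fwd_cball_iff)
    have "\<exists>a\<in>?B. d (f a) x < \<delta> \<and> d x (f a) < \<delta>" if x: "x \<in> fwd_cball X d p R" for x
    proof -
      have "x \<in> fwd_cball X d p (R + 1 - e)"
        using x e by (simp add: mem_fwd_cball_iff)
      then obtain a where a: "a \<in> ?B" "d (f a) x < e"
        using f(4) by (auto simp: mem_fwd_nbhd_iff subset_iff)
      \<comment> \<open>Since \<open>f\<close> respects base points, its values lie within
        \<open>R + 1 + e\<close> of \<open>p\<close>, hence in the ball where the factor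
        \<open>\<Theta> (R + 2)\<close> applies.\<close>
      have "d p (f a) \<le> R + 2"
        using dis[OF pi a(1)] a(1) e f(2) by (simp add: mem_fwd_cball_iff abs_le_iff)
      then have "d x (f a) \<le> \<Theta> (R + 2) * d (f a) x"
        using x a f(1) R by (intro pointed_Theta_class_reverse[OF C(2)]) (auto simp: mem_fwd_cball_iff)
      also have "\<dots> < \<Theta> (R + 2) * e"
        using a L by simp
      finally show ?thesis
        using a e e\<delta> by (intro bexI[of _ a]) auto
    qed
    moreover have "\<forall>a \<in> ?B. \<forall>b \<in> ?B. \<bar>d (f a) (f b) - ds i a b\<bar> \<le> \<delta>"
      using dis e\<delta> by (meson order_trans)
    ultimately show "\<exists>f. f (ps i) = p \<and> almost_isometry \<delta> ?B (ds i) X d f (fwd_cball X d p R)"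
      using f(1,2) unfolding almost_isometry_def by blast
  qed
qed

section \<open>Uniqueness of the limit\<close>

text \<open>For finite \<open>F\<close> and \<open>G\<close> only finitely many values of
  \<open>h\<close> and \<open>k\<close> enter, each through a distance, which gives closed
  conditions in the product topology. That \<open>h\<close> and \<open>k\<close> are nearly inverse
  is expressed by comparing \<open>e y (h x)\<close> with \<open>d (k y) x\<close>, because a
  composite \<open>h (k y)\<close> is not a coordinate evaluation.\<close>

definition almost_inverse_isometries where
  "almost_inverse_isometries p d q e F G \<delta> h k \<longleftrightarrow>
     (\<forall>x\<in>F. \<forall>y\<in>F. \<bar>e (h x) (h y) - d x y\<bar> \<le> \<delta>) \<and>
     (\<forall>x\<in>F. \<bar>e q (h x) - d p x\<bar> \<le> \<delta>) \<and>
     (\<forall>y\<in>G. \<bar>d p (k y) - e q y\<bar> \<le> \<delta>) \<and>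
     (\<forall>x\<in>F. \<forall>y\<in>G. \<bar>e y (h x) - d (k y) x\<bar> \<le> (\<delta>::real))"

lemma almost_inverse_isometries_mono:
  assumes "almost_inverse_isometries p d q e F G \<delta> h k" "F' \<subseteq> F" "G' \<subseteq> G" "\<delta> \<le> \<delta>'"
  shows "almost_inverse_isometries p d q e F' G' \<delta>' h k"
  using assms unfolding almost_inverse_isometries_def by (meson order_trans subsetD)

lemma closedin_Collect_Ball:
  assumes "\<And>x. x \<in> F \<Longrightarrow> closedin T {z \<in> topspace T. Q x z}"
  shows "closedin T {z \<in> topspace T. \<forall>x\<in>F. Q x z}"
proof (cases "F = {}")
  \<comment> \<open>The empty family is treated apart, because its intersection is the whole type
    rather than \<open>topspace T\<close>.\<close>
  case False
  then have "{z \<in> topspace T. \<forall>x\<in>F. Q x z} = (\<Inter>x\<in>F. {z \<in> topspace T. Q x z})"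
    by auto
  then show ?thesis
    using assms False by auto
qed auto

lemma closedin_Collect_abs_diff_le:
  assumes "continuous_map T euclideanreal \<phi>" "continuous_map T euclideanreal \<psi>"
  shows "closedin T {z \<in> topspace T. \<bar>\<phi> z - \<psi> z\<bar> \<le> \<delta>}"
  using closedin_continuous_map_preimage[OF continuous_map_real_abs[OF continuous_map_diff[OF assms]],
      of "{..\<delta>}"] by simp

text \<open>
  In the limit the last condition of \<^const>\<open>almost_inverse_isometries\<close>, taken at \<open>x = k y\<close>, reads
  \<open>e y (h (k y)) = d (k y) (k y) = 0\<close>, which makes \<open>h\<close> surjective.
\<close>

lemma pointed_isometric_if_almost_inverse_isometriess:
  assumes X: "pointed_Theta_class \<Theta> X p d" and Y: "pointed_Theta_class \<Theta>' Y q e"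
    and approx: "\<And>F G \<delta>. \<lbrakk>finite F; F \<subseteq> X; finite G; G \<subseteq> Y; 0 < \<delta>\<rbrakk> \<Longrightarrow>
      \<exists>h\<in>F \<rightarrow> Y. \<exists>k\<in>G \<rightarrow> X. almost_inverse_isometries p d q e F G \<delta> h k"
  shows "pointed_isometric X p d Y q e"
proof -
  note CX = pointed_Theta_classD[OF X] and CY = pointed_Theta_classD[OF Y]
  note MX = irreversible_metricD[OF CX(1)] and MY = irreversible_metricD[OF CY(1)]
  note tX = topspace_fwd_topology[OF CX(1)] and tY = topspace_fwd_topology[OF CY(1)]
  let ?TX = "fwd_topology X d" and ?TY = "fwd_topology Y e"
  define P where "P = prod_topology (product_topology (\<lambda>_. ?TY) X) (product_topology (\<lambda>_. ?TX) Y)"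
  \<comment> \<open>The values of an almost isometry with tolerance at most 1 lie in these balls.
    The summand 1 also makes the radius positive, as bounded compactness requires.\<close>
  define K where "K x = fwd_cball Y e q (d p x + 1)" for x
  define K' where "K' y = fwd_cball X d p (e q y + 1)" for y
  define S where "S = PiE X K \<times> PiE Y K'"
  define I where "I = {(F, G, \<delta>::real). finite F \<and> F \<subseteq> X \<and> finite G \<and> G \<subseteq> Y \<and> 0 < \<delta>}"
  define C where "C = (\<lambda>(F, G, \<delta>). {z \<in> topspace P. almost_inverse_isometries p d q e F G \<delta> (fst z) (snd z)})"
  have pos: "0 < d p x + 1" if "x \<in> X" for x
    using MX(1)[OF CX(2) that] by simp
  have pos': "0 < e q y + 1" if "y \<in> Y" for y
    using MY(1)[OF CY(2) that] by simp
  have "compactin P S"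
    unfolding P_def S_def using CX(4) CY(4) CX(2) CY(2) pos pos'
    by (simp add: compactin_Times compactin_PiE K_def K'_def)
  moreover have "closedin P c" if cI: "c \<in> C ` I" for c
  proof -
    obtain t where t: "t \<in> I" "c = C t"
      using cI by blast
    obtain F G \<delta> where "t = (F, G, \<delta>)"
      by (cases t)
    then have c: "c = C (F, G, \<delta>)" "F \<subseteq> X" "G \<subseteq> Y"
      using t by (simp_all add: I_def)
    have ch: "continuous_map P ?TY (\<lambda>z. fst z x)" if "x \<in> F" for x
      unfolding P_def using c that
      by (intro continuous_map_of_fst[unfolded o_def, THEN iffD2] disjI2
          continuous_map_product_projection) auto
    have ck: "continuous_map P ?TX (\<lambda>z. snd z y)" if "y \<in> G" for y
      unfolding P_def using c that
      by (intro continuous_map_of_snd[unfolded o_def, THEN iffD2] disjI2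
          continuous_map_product_projection) auto
    have cX: "continuous_map P ?TX (\<lambda>z. x)" if "x \<in> X" for x
      using that by (simp add: tX)
    have cY: "continuous_map P ?TY (\<lambda>z. y)" if "y \<in> Y" for y
      using that by (simp add: tY)
    have "closedin P ({z \<in> topspace P. \<forall>x\<in>F. \<forall>y\<in>F. \<bar>e (fst z x) (fst z y) - d x y\<bar> \<le> \<delta>} \<inter>
       {z \<in> topspace P. \<forall>x\<in>F. \<bar>e q (fst z x) - d p x\<bar> \<le> \<delta>} \<inter>
       {z \<in> topspace P. \<forall>y\<in>G. \<bar>d p (snd z y) - e q y\<bar> \<le> \<delta>} \<inter>
       {z \<in> topspace P. \<forall>x\<in>F. \<forall>y\<in>G. \<bar>e y (fst z x) - d (snd z y) x\<bar> \<le> \<delta>})"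
      using c CX(2) CY(2)
      by (intro closedin_Int closedin_Collect_Ball closedin_Collect_abs_diff_le
          continuous_map_dist_comp[OF X] continuous_map_dist_comp[OF Y] ch ck cX cY) auto
    also have "\<dots> = c"
      unfolding c(1) C_def almost_inverse_isometries_def by auto
    finally show ?thesis .
  qed
  \<comment> \<open>Finitely many tests are implied by a single one, formed from the unions of their
    point sets and the least of their tolerances, and \<open>approx\<close> provides maps passing
    it.\<close>
  moreover have "S \<inter> \<Inter>\<F> \<noteq> {}" if \<F>: "finite \<F>" "\<F> \<subseteq> C ` I" for \<F>
  proof -
    obtain J where J: "finite J" "J \<subseteq> I" "\<F> = C ` J"
      using \<F> finite_subset_image by meson
    \<comment> \<open>Inserting 1 gives a minimum even when \<open>J\<close> is empty, and keeps
      \<open>\<delta> \<le> 1\<close> so that the values fall into the balls \<open>K\<close> and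
      \<open>K'\<close>.\<close>
    define F G \<delta> where "F = \<Union>(fst ` J)" and "G = \<Union>((fst \<circ> snd) ` J)"
      and "\<delta> = Min (insert 1 ((snd \<circ> snd) ` J))"
    have FG: "finite F" "F \<subseteq> X" "finite G" "G \<subseteq> Y"
      using J(1) J(2)[THEN subsetD] by (force simp: F_def G_def I_def)+
    have \<delta>: "0 < \<delta>" "\<delta> \<le> 1"
      using J(1) J(2)[THEN subsetD] by (force simp: \<delta>_def I_def)+
    obtain h k where hk: "h \<in> F \<rightarrow> Y" "k \<in> G \<rightarrow> X" "almost_inverse_isometries p d q e F G \<delta> h k"
      using approx[OF FG \<delta>(1)] by blast
    \<comment> \<open>Outside \<open>F\<close> and \<open>G\<close> the base points serve as default
      values, since they lie in all the balls; the conditions only concern \<open>F\<close> and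
      \<open>G\<close>. Restriction makes both maps extensional, as \<open>PiE\<close>
      demands.\<close>
    define h' where "h' = (\<lambda>x\<in>X. if x \<in> F then h x else q)"
    define k' where "k' = (\<lambda>y\<in>Y. if y \<in> G then k y else p)"
    have hk': "almost_inverse_isometries p d q e F G \<delta> h' k'"
      using hk(3) FG unfolding almost_inverse_isometries_def h'_def k'_def by (simp add: subset_iff)
    have "h' x \<in> K x" if "x \<in> X" for x
    proof (cases "x \<in> F")
      case True
      then have "\<bar>e q (h x) - d p x\<bar> \<le> \<delta>"
        using hk(3) unfolding almost_inverse_isometries_def by blast
      then show ?thesis
        using True that hk(1) \<delta> by (auto simp: K_def h'_def mem_fwd_cball_iff)
    next
      case False
      then show ?thesis
        using that pos[OF that] CY(2) MY(3)[OF CY(2)] by (simp add: K_def h'_def mem_fwd_cball_iff)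
    qed
    moreover have "k' y \<in> K' y" if "y \<in> Y" for y
    proof (cases "y \<in> G")
      case True
      then have "\<bar>d p (k y) - e q y\<bar> \<le> \<delta>"
        using hk(3) unfolding almost_inverse_isometries_def by blast
      then show ?thesis
        using True that hk(2) \<delta> by (auto simp: K'_def k'_def mem_fwd_cball_iff)
    next
      case False
      then show ?thesis
        using that pos'[OF that] CX(2) MX(3)[OF CX(2)] by (simp add: K'_def k'_def mem_fwd_cball_iff)
    qed
    ultimately have S: "(h', k') \<in> S"
      by (auto simp: S_def h'_def k'_def)
    then have "(h', k') \<in> topspace P"
      using \<open>compactin P S\<close> compactin_subset_topspace by blast
    moreover have "almost_inverse_isometries p d q e A B \<epsilon> h' k'" if "(A, B, \<epsilon>) \<in> J" for A B \<epsilon>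
    proof (rule almost_inverse_isometries_mono[OF hk'])
      show "A \<subseteq> F" "B \<subseteq> G"
        using that by (force simp: F_def G_def)+
      have "\<epsilon> \<in> (snd \<circ> snd) ` J"
        using that by force
      then show "\<delta> \<le> \<epsilon>"
        using J(1) by (simp add: \<delta>_def)
    qed
    ultimately have "(h', k') \<in> \<Inter>\<F>"
      by (auto simp: J(3) C_def)
    then show ?thesis using S by blast
  qed
  ultimately have "S \<inter> \<Inter>(C ` I) \<noteq> {}"
    unfolding compactin_fip by simp
  then obtain h k where hk: "(h, k) \<in> S" "(h, k) \<in> \<Inter>(C ` I)"
    by auto
  have h: "h x \<in> Y" if "x \<in> X" for x
    using hk(1) that by (auto simp: S_def K_def mem_fwd_cball_iff PiE_iff)
  have k: "k y \<in> X" if "y \<in> Y" for y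
    using hk(1) that by (auto simp: S_def K'_def mem_fwd_cball_iff PiE_iff)
  have lim: "almost_inverse_isometries p d q e F G \<delta> h k"
    if "finite F" "F \<subseteq> X" "finite G" "G \<subseteq> Y" "0 < \<delta>" for F G \<delta>
    using hk(2) that by (auto simp: I_def C_def)
  \<comment> \<open>The limit maps pass the tests for every tolerance, so each approximate equality
    of distances becomes exact.\<close>
  have eq: "s = t" if "\<And>\<delta>. 0 < \<delta> \<Longrightarrow> \<bar>s - t\<bar> \<le> \<delta>" for s t :: real
    using field_le_epsilon[of "\<bar>s - t\<bar>" 0] that by auto
  have iso: "e (h x) (h y) = d x y" if "x \<in> X" "y \<in> X" for x y
    using lim[of "{x, y}" "{}"] that by (intro eq) (simp add: almost_inverse_isometries_def)
  have "e q (h p) = d p p"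
    using lim[of "{p}" "{}"] CX(2) by (intro eq) (simp add: almost_inverse_isometries_def)
  then have hp: "h p = q"
    using MX(3) MY(2)[OF CY(2) h] CX(2) by metis
  have "e y (h (k y)) = d (k y) (k y)" if "y \<in> Y" for y
    using lim[of "{k y}" "{y}"] that k by (intro eq) (simp add: almost_inverse_isometries_def)
  then have "h (k y) = y" if "y \<in> Y" for y
    using that MX(3)[OF k] MY(2)[OF that h[OF k]] by metis
  then have "h ` X = Y"
    using h k by force
  then show ?thesis
    unfolding pointed_isometric_def
    using isometry_homeomorphic_map[OF CX(1) CY(1)] iso hp by blast
qed

text \<open>For a large index \<open>i\<close> let \<open>f\<close> and \<open>g\<close> approximate
  \<open>X\<close> and \<open>Y\<close> on the same ball of \<open>Xs i\<close>. Each
  \<open>x\<close> in \<open>F\<close> has an almost preimage \<open>a x\<close> under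
  \<open>f\<close>, and \<open>g\<close> carries it on to \<open>Y\<close>; with almost preimages
  \<open>b y\<close> under \<open>g\<close>, the map \<open>f \<circ> b\<close> goes back.\<close>

lemma fwd_GH_limit_unique:
  assumes convX: "fwd_GH_converges \<Theta> Xs ps ds X p d" and convY: "fwd_GH_converges \<Theta>' Xs ps ds Y q e"
  shows "pointed_isometric X p d Y q e"
proof (rule pointed_isometric_if_almost_inverse_isometriess)
  show cX: "pointed_Theta_class \<Theta> X p d"
    using fwd_GH_convergesD(2)[OF convX] .
  show cY: "pointed_Theta_class \<Theta>' Y q e"
    using fwd_GH_convergesD(2)[OF convY] .
  note CX = pointed_Theta_classD[OF cX] and CY = pointed_Theta_classD[OF cY]
  note MX = irreversible_metricD[OF CX(1)] and MY = irreversible_metricD[OF CY(1)]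
  fix F G and \<delta> :: real
  assume FG: "finite F" "F \<subseteq> X" "finite G" "G \<subseteq> Y" and \<delta>: "0 < \<delta>"
  \<comment> \<open>The balls of radius \<open>R\<close> contain all test points; inserting 1 covers
    empty test sets and makes \<open>R\<close> positive.\<close>
  define R where "R = Max (insert 1 (d p ` F \<union> e q ` G))"
  have R: "1 \<le> R" "\<And>x. x \<in> F \<Longrightarrow> d p x \<le> R" "\<And>y. y \<in> G \<Longrightarrow> e q y \<le> R"
    using FG by (auto simp: R_def)
  have R0: "0 < R" using R by simp
  have \<delta>4: "0 < \<delta> / 4" using \<delta> by simp
  define B where "B i = fwd_cball (Xs i) (ds i) (ps i) (R + 1)" for i
  obtain N where N: "\<forall>i>N. \<exists>f. f (ps i) = p \<and>
      almost_isometry (\<delta> / 4) (B i) (ds i) X d f (fwd_cball X d p R)"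
    using fwd_GH_approximation[OF convX R0 \<delta>4] unfolding B_def by blast
  obtain N' where N': "\<forall>i>N'. \<exists>g. g (ps i) = q \<and>
      almost_isometry (\<delta> / 4) (B i) (ds i) Y e g (fwd_cball Y e q R)"
    using fwd_GH_approximation[OF convY R0 \<delta>4] unfolding B_def by blast
  define i where "i = Suc (max N N')"
  have i: "N < i" "N' < i" by (simp_all add: i_def)
  obtain f where f: "f (ps i) = p" "almost_isometry (\<delta> / 4) (B i) (ds i) X d f (fwd_cball X d p R)"
    using N i(1) by blast
  obtain g where g: "g (ps i) = q" "almost_isometry (\<delta> / 4) (B i) (ds i) Y e g (fwd_cball Y e q R)"
    using N' i(2) by blast
  have "\<forall>x\<in>F. \<exists>a\<in>B i. d (f a) x < \<delta> / 4 \<and> d x (f a) < \<delta> / 4"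
    using f(2) R(2) FG unfolding almost_isometry_def by (auto simp: mem_fwd_cball_iff)
  then obtain a where a: "\<And>x. x \<in> F \<Longrightarrow> a x \<in> B i \<and> d (f (a x)) x < \<delta> / 4 \<and> d x (f (a x)) < \<delta> / 4"
    by metis
  have "\<forall>y\<in>G. \<exists>a\<in>B i. e (g a) y < \<delta> / 4 \<and> e y (g a) < \<delta> / 4"
    using g(2) R(3) FG unfolding almost_isometry_def by (auto simp: mem_fwd_cball_iff)
  then obtain b where b: "\<And>y. y \<in> G \<Longrightarrow> b y \<in> B i \<and> e (g (b y)) y < \<delta> / 4 \<and> e y (g (b y)) < \<delta> / 4"
    by metis
  have Mi: "irreversible_metric (Xs i) (ds i)" "ps i \<in> Xs i"
    using pointed_Theta_classD[OF fwd_GH_convergesD(1)[OF convX, of i]] by auto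
  have pi: "ps i \<in> B i"
    using Mi irreversible_metricD(3)[OF Mi(1) Mi(2)] R by (simp add: B_def mem_fwd_cball_iff)
  have fX: "f u \<in> X" and gY: "g u \<in> Y" if "u \<in> B i" for u
    using f(2) g(2) that unfolding almost_isometry_def by auto
  have fg: "\<bar>e (g u) (g v) - d (f u) (f v)\<bar> \<le> \<delta> / 2" if "u \<in> B i" "v \<in> B i" for u v
  proof -
    have "\<bar>d (f u) (f v) - ds i u v\<bar> \<le> \<delta> / 4" "\<bar>e (g u) (g v) - ds i u v\<bar> \<le> \<delta> / 4"
      using f(2) g(2) that unfolding almost_isometry_def by auto
    then show ?thesis by linarith
  qed
  have aF: "a x \<in> B i" "x \<in> X" "f (a x) \<in> X" "g (a x) \<in> Y" "d (f (a x)) x < \<delta> / 4" "d x (f (a x)) < \<delta> / 4"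
    if "x \<in> F" for x
    using a[OF that] fX gY FG(2) that by auto
  have bG: "b y \<in> B i" "y \<in> Y" "f (b y) \<in> X" "g (b y) \<in> Y" "e (g (b y)) y < \<delta> / 4" "e y (g (b y)) < \<delta> / 4"
    if "y \<in> G" for y
    using b[OF that] fX gY FG(4) that by auto
  have "\<bar>e (g (a x)) (g (a y)) - d x y\<bar> \<le> \<delta>" if xy: "x \<in> F" "y \<in> F" for x y
  proof -
    note x = aF[OF xy(1)] and y = aF[OF xy(2)]
    have "\<bar>d (f (a x)) (f (a y)) - d x y\<bar> \<le> \<delta> / 2"
      using MX(4)[OF x(3) x(2) y(3)] MX(4)[OF x(2) y(2) y(3)]
        MX(4)[OF x(2) x(3) y(2)] MX(4)[OF x(3) y(3) y(2)] x y by linarith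
    then show ?thesis using fg[OF x(1) y(1)] by linarith
  qed
  moreover have "\<bar>e q (g (a x)) - d p x\<bar> \<le> \<delta>" if "x \<in> F" for x
  proof -
    note x = aF[OF that]
    show ?thesis
      using fg[OF pi x(1)] MX(4)[OF CX(2) x(3) x(2)] MX(4)[OF CX(2) x(2) x(3)] x \<delta>
      unfolding f(1) g(1) by linarith
  qed
  moreover have "\<bar>d p (f (b y)) - e q y\<bar> \<le> \<delta>" if "y \<in> G" for y
  proof -
    note y = bG[OF that]
    show ?thesis
      using fg[OF pi y(1)] MY(4)[OF CY(2) y(4) y(2)] MY(4)[OF CY(2) y(2) y(4)] y \<delta>
      unfolding f(1) g(1) by linarith
  qed
  \<comment> \<open>Half of the tolerance pays for passing between \<open>f\<close> and
    \<open>g\<close>, a quarter for replacing \<open>f (a x)\<close> by \<open>x\<close> and a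
    quarter for replacing \<open>g (b y)\<close> by \<open>y\<close>.\<close>
  moreover have "\<bar>e y (g (a x)) - d (f (b y)) x\<bar> \<le> \<delta>" if xy: "x \<in> F" "y \<in> G" for x y
  proof -
    note x = aF[OF xy(1)] and y = bG[OF xy(2)]
    show ?thesis
      using fg[OF y(1) x(1)] MX(4)[OF y(3) x(3) x(2)] MX(4)[OF y(3) x(2) x(3)]
        MY(4)[OF y(2) y(4) x(4)] MY(4)[OF y(4) y(2) x(4)] x y by linarith
  qed
  ultimately have "almost_inverse_isometries p d q e F G \<delta> (g \<circ> a) (f \<circ> b)"
    unfolding almost_inverse_isometries_def by simp
  moreover have "g \<circ> a \<in> F \<rightarrow> Y" "f \<circ> b \<in> G \<rightarrow> X"
    using a b fX gY by auto
  ultimately show "\<exists>h\<in>F \<rightarrow> Y. \<exists>k\<in>G \<rightarrow> X. almost_inverse_isometries p d q e F G \<delta> h k"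
    by blast
qed

section \<open>Enlarging the reversibility bound\<close>

lemma pointed_Theta_class_mono:
  assumes "pointed_Theta_class \<Theta> X p d" "\<And>r. 0 < r \<Longrightarrow> \<Theta> r \<le> \<Theta>' r"
  shows "pointed_Theta_class \<Theta>' X p d"
  using assms unfolding pointed_Theta_class_def pointed_fwd_Theta_space_def
  by (metis ereal_less_eq(3) order_trans)

text \<open>The bound enters only through membership in the class, so the same approximations
  serve.\<close>

lemma fwd_GH_converges_mono:
  assumes "fwd_GH_converges \<Theta> Xs ps ds X p d" "\<And>r. 0 < r \<Longrightarrow> \<Theta> r \<le> \<Theta>' r"
  shows "fwd_GH_converges \<Theta>' Xs ps ds X p d"
proof -
  have "\<And>i. pointed_Theta_class \<Theta>' (Xs i) (ps i) (ds i)" "pointed_Theta_class \<Theta>' X p d"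
    using fwd_GH_convergesD[OF assms(1)] pointed_Theta_class_mono assms(2) by metis+
  then show ?thesis
    using assms(1) unfolding fwd_GH_converges_def by blast
qed

section \<open>Comparison with Gromov-Hausdorff convergence\<close>

lemma hausdorff_distance_nonneg: "0 \<le> hausdorff_distance Z d A B"
  unfolding hausdorff_distance_def by (rule Inf_greatest) auto

lemma theta_GH_distance_nonneg: "0 \<le> theta_GH_distance \<theta> A d1 B d2"
  unfolding theta_GH_distance_def by (rule Inf_greatest) (auto simp: hausdorff_distance_nonneg)

lemma theta_GH_distance_leI:
  assumes "theta_admissible \<theta> A d1 B d2 D" "0 < \<eta>"
    and "\<And>x. x \<in> A \<Longrightarrow> \<exists>y\<in>B. D (Inr y) (Inl x) < \<eta>"
    and "\<And>y. y \<in> B \<Longrightarrow> \<exists>x\<in>A. D (Inl x) (Inr y) < \<eta>"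
  shows "theta_GH_distance \<theta> A d1 B d2 \<le> ereal \<eta>"
proof -
  have "hausdorff_distance (A <+> B) D (Inl ` A) (Inr ` B) \<le> ereal \<eta>"
    unfolding hausdorff_distance_def
    by (rule Inf_lower) (use assms(2-4) in \<open>auto simp: mem_fwd_nbhd_iff\<close>)
  moreover have "theta_GH_distance \<theta> A d1 B d2 \<le> hausdorff_distance (A <+> B) D (Inl ` A) (Inr ` B)"
    unfolding theta_GH_distance_def by (rule Inf_lower) (use assms(1) in auto)
  ultimately show ?thesis by (rule order_trans[rotated])
qed

lemma theta_GH_distance_lessE:
  assumes "theta_GH_distance \<theta> A d1 B d2 < t"
  obtains D \<eta> where "theta_admissible \<theta> A d1 B d2 D" "0 < \<eta>" "ereal \<eta> < t"
    and "\<And>x. x \<in> A \<Longrightarrow> \<exists>y\<in>B. D (Inr y) (Inl x) < \<eta>"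
    and "\<And>y. y \<in> B \<Longrightarrow> \<exists>x\<in>A. D (Inl x) (Inr y) < \<eta>"
proof -
  obtain D where D: "theta_admissible \<theta> A d1 B d2 D"
      "hausdorff_distance (A <+> B) D (Inl ` A) (Inr ` B) < t"
    using assms unfolding theta_GH_distance_def Inf_less_iff by blast
  then obtain \<eta> where "0 < \<eta>" "ereal \<eta> < t" "Inl ` A \<subseteq> fwd_nbhd (A <+> B) D (Inr ` B) \<eta>"
      "Inr ` B \<subseteq> fwd_nbhd (A <+> B) D (Inl ` A) \<eta>"
    unfolding hausdorff_distance_def Inf_less_iff by blast
  then show ?thesis
    using D(1) by (intro that[of D \<eta>]) (auto simp: subset_iff mem_fwd_nbhd_iff)
qed

section \<open>Gluing two spaces along an approximation\<close>

text \<open>The infimum is taken over paths crossing exactly once between the two parts, along an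
  edge of length \<open>c\<close> that joins \<open>a\<close> and \<open>f a\<close>.\<close>

definition glued_dist ::
  "'a set \<Rightarrow> ('a \<Rightarrow> 'a \<Rightarrow> real) \<Rightarrow> ('b \<Rightarrow> 'b \<Rightarrow> real) \<Rightarrow> ('a \<Rightarrow> 'b) \<Rightarrow> real \<Rightarrow> 'a + 'b \<Rightarrow> 'a + 'b \<Rightarrow> real"
where
  "glued_dist A d1 d2 f c u v =
     (case (u, v) of
        (Inl x, Inl y) \<Rightarrow> d1 x y
      | (Inr x, Inr y) \<Rightarrow> d2 x y
      | (Inl x, Inr y) \<Rightarrow> (INF a\<in>A. d1 x a + c + d2 (f a) y)
      | (Inr y, Inl x) \<Rightarrow> (INF a\<in>A. d2 y (f a) + c + d1 a x))"

lemma glued_dist_simps [simp]: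
  "glued_dist A d1 d2 f c (Inl x) (Inl x') = d1 x x'"
  "glued_dist A d1 d2 f c (Inr y) (Inr y') = d2 y y'"
  by (simp_all add: glued_dist_def)

context
  fixes A :: "'a set" and d1 and B :: "'b set" and d2 f and c :: real
  assumes A: "irreversible_metric A d1" and B: "irreversible_metric B d2"
    and ne: "A \<noteq> {}" and f: "f \<in> A \<rightarrow> B" and c: "0 < c"
begin

private lemma fB: "a \<in> A \<Longrightarrow> f a \<in> B"
  using f by auto

lemma glued_dist_le:
  assumes "x \<in> A" "y \<in> B" "a \<in> A"
  shows "glued_dist A d1 d2 f c (Inl x) (Inr y) \<le> d1 x a + c + d2 (f a) y"
    and "glued_dist A d1 d2 f c (Inr y) (Inl x) \<le> d2 y (f a) + c + d1 a x"
  unfolding glued_dist_def using assms c fB irreversible_metricD(1)[OF A] irreversible_metricD(1)[OF B]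
  by (auto intro!: cINF_lower bdd_belowI[of _ 0] simp: add_nonneg_nonneg)

lemma le_glued_dist:
  shows "(\<And>a. a \<in> A \<Longrightarrow> t \<le> d1 x a + c + d2 (f a) y) \<Longrightarrow> t \<le> glued_dist A d1 d2 f c (Inl x) (Inr y)"
    and "(\<And>a. a \<in> A \<Longrightarrow> t \<le> d2 y (f a) + c + d1 a x) \<Longrightarrow> t \<le> glued_dist A d1 d2 f c (Inr y) (Inl x)"
  unfolding glued_dist_def using ne by (auto intro!: cINF_greatest)

lemma glued_dist_ge:
  assumes "x \<in> A" "y \<in> B"
  shows "c \<le> glued_dist A d1 d2 f c (Inl x) (Inr y)" "c \<le> glued_dist A d1 d2 f c (Inr y) (Inl x)"
  using assms fB irreversible_metricD(1)[OF A] irreversible_metricD(1)[OF B]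
  by (auto intro!: le_glued_dist)

text \<open>For a single crossing the inequality comes from the triangle inequality inside one part.
  A path that leaves a part and returns uses two edges, whose total length \<open>2 * c\<close>
  covers the distortion of \<open>f\<close>.\<close>

lemma glued_dist_triangle:
  assumes dis: "\<And>a b. a \<in> A \<Longrightarrow> b \<in> A \<Longrightarrow> \<bar>d2 (f a) (f b) - d1 a b\<bar> \<le> 2 * c"
    and uvw: "u \<in> A <+> B" "v \<in> A <+> B" "w \<in> A <+> B"
  shows "glued_dist A d1 d2 f c u w \<le> glued_dist A d1 d2 f c u v + glued_dist A d1 d2 f c v w"
proof -
  note MA = irreversible_metricD[OF A] and MB = irreversible_metricD[OF B]
  let ?g = "glued_dist A d1 d2 f c"
  have LLR: "?g (Inl x) (Inr y) \<le> d1 x x' + ?g (Inl x') (Inr y)" if "x \<in> A" "x' \<in> A" "y \<in> B" for x x' y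
  proof -
    \<comment> \<open>With the fixed distance moved to the left, the right-hand side is a bare
      infimum and can be bounded below term by term.\<close>
    have "?g (Inl x) (Inr y) - d1 x x' \<le> ?g (Inl x') (Inr y)"
      using that glued_dist_le(1)[of x y] MA(4)[of x x'] by (force intro!: le_glued_dist)
    then show ?thesis by simp
  qed
  have RLL: "?g (Inr y) (Inl x) \<le> ?g (Inr y) (Inl x') + d1 x' x" if "x \<in> A" "x' \<in> A" "y \<in> B" for x x' y
  proof -
    have "?g (Inr y) (Inl x) - d1 x' x \<le> ?g (Inr y) (Inl x')"
      using that glued_dist_le(2)[of x y] MA(4)[of _ x' x] by (force intro!: le_glued_dist)
    then show ?thesis by simp
  qed
  have LRR: "?g (Inl x) (Inr y) \<le> ?g (Inl x) (Inr y') + d2 y' y" if "x \<in> A" "y' \<in> B" "y \<in> B" for x y' y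
  proof -
    have "?g (Inl x) (Inr y) - d2 y' y \<le> ?g (Inl x) (Inr y')"
      using that glued_dist_le(1)[of x y] MB(4)[of _ y' y] fB by (force intro!: le_glued_dist)
    then show ?thesis by simp
  qed
  have RRL: "?g (Inr y) (Inl x) \<le> d2 y y' + ?g (Inr y') (Inl x)" if "x \<in> A" "y' \<in> B" "y \<in> B" for x y' y
  proof -
    have "?g (Inr y) (Inl x) - d2 y y' \<le> ?g (Inr y') (Inl x)"
      using that glued_dist_le(2)[of x y] MB(4)[of y y'] fB by (force intro!: le_glued_dist)
    then show ?thesis by simp
  qed
  have LRL: "d1 x x' \<le> ?g (Inl x) (Inr y) + ?g (Inr y) (Inl x')" if "x \<in> A" "x' \<in> A" "y \<in> B" for x x' y
  proof -
    \<comment> \<open>The detour runs from \<open>f a\<close> over \<open>y\<close> to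
      \<open>f b\<close>, and \<open>d1 a b \<le> d2 (f a) (f b) + 2 * c\<close>. Afterwards the
      infima over \<open>b\<close> and over \<open>a\<close> are taken one at a time.\<close>
    have "d1 x x' \<le> (d1 x a + c + d2 (f a) y) + (d2 y (f b) + c + d1 b x')" if "a \<in> A" "b \<in> A" for a b
      using dis[OF that] MB(4)[of "f a" y "f b"] MA(4)[of x a x'] MA(4)[of a b x'] that fB
        \<open>x \<in> A\<close> \<open>x' \<in> A\<close> \<open>y \<in> B\<close> by (simp add: abs_le_iff)
    then have "d1 x x' - (d1 x a + c + d2 (f a) y) \<le> ?g (Inr y) (Inl x')" if "a \<in> A" for a
      using that by (force intro!: le_glued_dist simp: algebra_simps)
    then have "d1 x x' - ?g (Inr y) (Inl x') \<le> ?g (Inl x) (Inr y)"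
      by (force intro!: le_glued_dist simp: algebra_simps)
    then show ?thesis by simp
  qed
  have RLR: "d2 y y' \<le> ?g (Inr y) (Inl x) + ?g (Inl x) (Inr y')" if "y \<in> B" "y' \<in> B" "x \<in> A" for x y y'
  proof -
    have "d2 y y' \<le> (d2 y (f a) + c + d1 a x) + (d1 x b + c + d2 (f b) y')" if "a \<in> A" "b \<in> A" for a b
      using dis[OF that] MA(4)[of a x b] MB(4)[of y "f a" y'] MB(4)[of "f a" "f b" y'] that fB
        \<open>x \<in> A\<close> \<open>y' \<in> B\<close> \<open>y \<in> B\<close> by (simp add: abs_le_iff)
    then have "d2 y y' - (d2 y (f a) + c + d1 a x) \<le> ?g (Inl x) (Inr y')" if "a \<in> A" for a
      using that by (force intro!: le_glued_dist simp: algebra_simps)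
    then have "d2 y y' - ?g (Inl x) (Inr y') \<le> ?g (Inr y) (Inl x)"
      by (force intro!: le_glued_dist simp: algebra_simps)
    then show ?thesis by simp
  qed
  show ?thesis
    using uvw by (elim PlusE) (auto intro: MA(4) MB(4) LLR RLL LRR RRL LRL RLR)
qed

text \<open>Reversing a path while keeping its crossing point \<open>a\<close> changes each of its
  three summands by a factor of at most \<open>\<theta>\<close>. Positivity of \<open>c\<close>
  keeps the two parts apart.\<close>

lemma theta_admissible_glued_dist:
  assumes dis: "\<And>a b. a \<in> A \<Longrightarrow> b \<in> A \<Longrightarrow> \<bar>d2 (f a) (f b) - d1 a b\<bar> \<le> 2 * c"
    and revA: "reversibility d1 A \<le> ereal \<theta>" and revB: "reversibility d2 B \<le> ereal \<theta>"
  shows "theta_admissible \<theta> A d1 B d2 (glued_dist A d1 d2 f c)"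
proof -
  note MA = irreversible_metricD[OF A] and MB = irreversible_metricD[OF B]
  let ?g = "glued_dist A d1 d2 f c"
  have \<theta>: "1 \<le> \<theta>" using reversibility_ge_1[OF revA] .
  have rA: "d1 x y \<le> \<theta> * d1 y x" if "x \<in> A" "y \<in> A" for x y
    using reversibilityD[OF revA that] MA(1) that by simp
  have rB: "d2 x y \<le> \<theta> * d2 y x" if "x \<in> B" "y \<in> B" for x y
    using reversibilityD[OF revB that] MB(1) that by simp
  have \<theta>c: "c \<le> \<theta> * c" using \<theta> c by simp
  have LR: "?g (Inl x) (Inr y) \<le> \<theta> * ?g (Inr y) (Inl x)" if "x \<in> A" "y \<in> B" for x y
  proof -
    \<comment> \<open>Division by \<open>\<theta>\<close> leaves the infimum alone on the
      right.\<close>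
    have "?g (Inl x) (Inr y) / \<theta> \<le> ?g (Inr y) (Inl x)"
    proof (rule le_glued_dist)
      fix a assume "a \<in> A"
      then have "?g (Inl x) (Inr y) \<le> \<theta> * (d2 y (f a) + c + d1 a x)"
        using glued_dist_le(1)[OF that, of a] rA[of x a] rB[of "f a" y] that fB \<theta>c
        by (simp add: algebra_simps)
      then show "?g (Inl x) (Inr y) / \<theta> \<le> d2 y (f a) + c + d1 a x"
        using \<theta> by (simp add: field_simps)
    qed
    then show ?thesis using \<theta> by (simp add: field_simps)
  qed
  have RL: "?g (Inr y) (Inl x) \<le> \<theta> * ?g (Inl x) (Inr y)" if "x \<in> A" "y \<in> B" for x y
  proof -
    have "?g (Inr y) (Inl x) / \<theta> \<le> ?g (Inl x) (Inr y)"
    proof (rule le_glued_dist)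
      fix a assume "a \<in> A"
      then have "?g (Inr y) (Inl x) \<le> \<theta> * (d1 x a + c + d2 (f a) y)"
        using glued_dist_le(2)[OF that, of a] rA[of a x] rB[of y "f a"] that fB \<theta>c
        by (simp add: algebra_simps)
      then show "?g (Inr y) (Inl x) / \<theta> \<le> d1 x a + c + d2 (f a) y"
        using \<theta> by (simp add: field_simps)
    qed
    then show ?thesis using \<theta> by (simp add: field_simps)
  qed
  have cross: "0 < ?g (Inl x) (Inr y)" "0 < ?g (Inr y) (Inl x)" if "x \<in> A" "y \<in> B" for x y
    using glued_dist_ge[OF that] c by simp_all
  have "irreversible_metric (A <+> B) ?g"
    unfolding irreversible_metric_def
  proof (intro conjI ballI)
    fix u v assume uv: "u \<in> A <+> B" "v \<in> A <+> B"
    show "0 \<le> ?g u v"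
      using uv by (elim PlusE) (auto simp: MA(1) MB(1) cross less_imp_le)
    show "?g u v = 0 \<longleftrightarrow> u = v"
      using uv by (elim PlusE) (auto simp: MA(2) MB(2) dest: cross)
  qed (rule glued_dist_triangle[OF dis])
  moreover have "reversibility ?g (A <+> B) \<le> ereal \<theta>"
    using \<theta> by (intro reversibilityI) (auto simp: rA rB LR RL)
  ultimately show ?thesis
    unfolding theta_admissible_def by simp
qed

end

section \<open>From forward convergence to Gromov-Hausdorff convergence\<close>

text \<open>The closed forward ball of radius \<open>D\<close> about \<open>p\<close> is the whole
  space, so its reversibility bound and its compactness are global.\<close>

lemma bounded_pointed_Theta_class:
  assumes C: "pointed_Theta_class \<Theta> X p d" and D: "0 < D" "\<And>x y. x \<in> X \<Longrightarrow> y \<in> X \<Longrightarrow> d x y \<le> D"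
    and \<theta>: "\<Theta> D \<le> \<theta>"
  shows "compact_theta_space \<theta> X d"
proof -
  note CX = pointed_Theta_classD[OF C]
  have "fwd_cball X d p D = X"
    using D(2) CX(2) by (auto simp: mem_fwd_cball_iff)
  then show ?thesis
    unfolding compact_theta_space_def compact_space_def topspace_fwd_topology[OF CX(1)]
    using CX D(1) \<theta> by (metis empty_iff ereal_less_eq(3) order_trans)
qed

lemma tendsto_ereal_zeroI:
  fixes u :: "nat \<Rightarrow> ereal"
  assumes "\<And>i. 0 \<le> u i" "\<And>\<epsilon>. 0 < \<epsilon> \<Longrightarrow> \<exists>N. \<forall>i>N. u i \<le> ereal \<epsilon>"
  shows "u \<longlonglongrightarrow> 0"
proof (rule order_tendstoI)
  fix a :: ereal assume "a < 0"
  then show "eventually (\<lambda>i. a < u i) sequentially"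
    using assms(1) order_less_le_trans by (intro always_eventually) blast
next
  fix a :: ereal assume "0 < a"
  then obtain \<epsilon> where \<epsilon>: "0 < \<epsilon>" "ereal \<epsilon> < a"
    using ereal_dense2[of 0 a] by auto
  then obtain N where "\<forall>i>N. u i \<le> ereal \<epsilon>"
    using assms(2) by blast
  then show "eventually (\<lambda>i. u i < a) sequentially"
    using \<epsilon>(2) unfolding eventually_sequentially by (meson Suc_le_eq le_less_trans)
qed

lemma fwd_GH_converges_imp_theta_GH_converges:
  assumes conv: "fwd_GH_converges \<Theta> Xs ps ds X p d" and D: "0 < D"
    and diam: "\<And>i. Diam (Xs i) (ds i) \<le> ereal D" and \<theta>: "\<Theta> D \<le> \<theta>"
  shows "theta_GH_converges \<theta> Xs ds X d"
proof -
  note Ci = fwd_GH_convergesD(1)[OF conv] and C = fwd_GH_convergesD(2)[OF conv]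
  note Mi = irreversible_metricD[OF pointed_Theta_classD(1)[OF Ci]]
  note M = irreversible_metricD[OF pointed_Theta_classD(1)[OF C]]
  have Di: "ds i x y \<le> D" if "x \<in> Xs i" "y \<in> Xs i" for i x y
    using diam[of i] that by (simp add: Diam_def SUP_le_iff)
  \<comment> \<open>The limit inherits the diameter bound: \<open>x\<close> and \<open>y\<close> are
    replaced by images of points of one \<open>Xs i\<close>, with three errors of
    \<open>e / 3\<close>.\<close>
  have DX: "d x y \<le> D" if xy: "x \<in> X" "y \<in> X" for x y
  proof (rule field_le_epsilon)
    fix e :: real assume "0 < e"
    define R where "R = max (d p x) (d p y) + 1"
    have R: "0 < R" "d p x \<le> R" "d p y \<le> R"
      using M(1)[OF pointed_Theta_classD(2)[OF C] xy(1)] by (auto simp: R_def)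
    define B where "B i = fwd_cball (Xs i) (ds i) (ps i) (R + 1)" for i
    obtain i f where f: "almost_isometry (e / 3) (B i) (ds i) X d f (fwd_cball X d p R)"
      using fwd_GH_approximation[OF conv R(1), of "e / 3"] \<open>0 < e\<close> unfolding B_def
      by (metis lessI zero_less_divide_iff zero_less_numeral)
    have "x \<in> fwd_cball X d p R" "y \<in> fwd_cball X d p R"
      using xy R by (auto simp: mem_fwd_cball_iff)
    then obtain a b where ab: "a \<in> B i" "b \<in> B i" "d x (f a) < e / 3" "d (f b) y < e / 3"
      using f unfolding almost_isometry_def by blast
    then have "ds i a b \<le> D"
      by (intro Di) (auto simp: B_def mem_fwd_cball_iff)
    moreover have "f a \<in> X" "f b \<in> X"
      using f ab unfolding almost_isometry_def by auto
    then have "d x y \<le> d x (f a) + d (f a) (f b) + d (f b) y"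
      using M(4)[of x "f a" y] M(4)[of "f a" "f b" y] xy by simp
    moreover have "\<bar>d (f a) (f b) - ds i a b\<bar> \<le> e / 3"
      using f ab unfolding almost_isometry_def by blast
    ultimately show "d x y \<le> D + e"
      using ab by linarith
  qed
  have cpt: "compact_theta_space \<theta> X d"
    using bounded_pointed_Theta_class[OF C D DX \<theta>] .
  have cpti: "compact_theta_space \<theta> (Xs i) (ds i)" for i
    using bounded_pointed_Theta_class[OF Ci D Di \<theta>] .
  have "\<exists>N. \<forall>i>N. theta_GH_distance \<theta> (Xs i) (ds i) X d \<le> ereal \<epsilon>" if \<epsilon>: "0 < \<epsilon>" for \<epsilon>
  proof -
    \<comment> \<open>The edges of the gluing get length \<open>\<epsilon> / 2\<close>, so that one
      edge followed by an error below \<open>\<epsilon> / 2\<close> stays below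
      \<open>\<epsilon>\<close>.\<close>
    have \<epsilon>2: "0 < \<epsilon> / 2" using \<epsilon> by simp
    obtain N where N: "\<forall>i>N. \<exists>f. f (ps i) = p \<and> almost_isometry (\<epsilon> / 2)
        (fwd_cball (Xs i) (ds i) (ps i) (D + 1)) (ds i) X d f (fwd_cball X d p D)"
      using fwd_GH_approximation[OF conv D \<epsilon>2] by blast
    have "theta_GH_distance \<theta> (Xs i) (ds i) X d \<le> ereal \<epsilon>" if i: "N < i" for i
    proof -
      have pi: "ps i \<in> Xs i" and p: "p \<in> X"
        using pointed_Theta_classD(2)[OF Ci] pointed_Theta_classD(2)[OF C] by simp_all
      \<comment> \<open>Both balls exhaust their spaces, so the approximation is defined on all of
        \<open>Xs i\<close> and almost reaches all of \<open>X\<close>.\<close>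
      have "fwd_cball (Xs i) (ds i) (ps i) (D + 1) = Xs i"
        using Di[OF pi] D by (force simp: mem_fwd_cball_iff)
      moreover have "fwd_cball X d p D = X"
        using DX[OF p] by (auto simp: mem_fwd_cball_iff)
      ultimately obtain f where f: "f \<in> Xs i \<rightarrow> X"
        "\<And>a b. a \<in> Xs i \<Longrightarrow> b \<in> Xs i \<Longrightarrow> \<bar>d (f a) (f b) - ds i a b\<bar> \<le> \<epsilon> / 2"
        "\<And>x. x \<in> X \<Longrightarrow> \<exists>a \<in> Xs i. d (f a) x < \<epsilon> / 2 \<and> d x (f a) < \<epsilon> / 2"
        using N i unfolding almost_isometry_def by metis
      have ne: "Xs i \<noteq> {}" using pi by blast
      note ctx = pointed_Theta_classD(1)[OF Ci[of i]] pointed_Theta_classD(1)[OF C] ne f(1) \<epsilon>2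
      have dis: "\<bar>d (f a) (f b) - ds i a b\<bar> \<le> 2 * (\<epsilon> / 2)" if "a \<in> Xs i" "b \<in> Xs i" for a b
        using f(2)[OF that] \<epsilon> by simp
      show ?thesis
      proof (rule theta_GH_distance_leI)
        show "theta_admissible \<theta> (Xs i) (ds i) X d (glued_dist (Xs i) (ds i) d f (\<epsilon> / 2))"
          using theta_admissible_glued_dist[OF ctx dis] cpt cpti[of i]
          unfolding compact_theta_space_def by blast
        show "0 < \<epsilon>" by fact
        show "\<exists>y\<in>X. glued_dist (Xs i) (ds i) d f (\<epsilon> / 2) (Inr y) (Inl x) < \<epsilon>" if "x \<in> Xs i" for x
          using glued_dist_le(2)[OF ctx that _ that, of "f x"] f(1) that M(3)[of "f x"] Mi(3)[OF that] \<epsilon>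
          by (intro bexI[of _ "f x"]) (auto simp: Pi_iff)
        show "\<exists>x\<in>Xs i. glued_dist (Xs i) (ds i) d f (\<epsilon> / 2) (Inl x) (Inr y) < \<epsilon>" if y: "y \<in> X" for y
        proof -
          obtain a where a: "a \<in> Xs i" "d (f a) y < \<epsilon> / 2"
            using f(3)[OF y] by blast
          then show ?thesis
            using glued_dist_le(1)[OF ctx a(1) y a(1)] Mi(3)[OF a(1)] by (intro bexI[of _ a]) auto
        qed
      qed
    qed
    then show ?thesis by blast
  qed
  then have "(\<lambda>i. theta_GH_distance \<theta> (Xs i) (ds i) X d) \<longlonglongrightarrow> 0"
    by (intro tendsto_ereal_zeroI theta_GH_distance_nonneg)
  then show ?thesis
    unfolding theta_GH_converges_def using cpt cpti by blast
qed

section \<open>From Gromov-Hausdorff convergence to forward convergence\<close>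

text \<open>A forward ball about an outside point \<open>y\<close> bounds \<open>d y z\<close>,
  whereas keeping \<open>z\<close> outside requires \<open>d z y\<close> to be small; the factor
  \<open>\<theta>\<close> links the two.\<close>

lemma closedin_fwd_cball:
  assumes X: "irreversible_metric X d" and rev: "reversibility d X \<le> ereal \<theta>" and x: "x \<in> X"
  shows "closedin (fwd_topology X d) (fwd_cball X d x r)"
  unfolding closedin_def topspace_fwd_topology[OF X]
proof (intro conjI)
  note M = irreversible_metricD[OF X]
  show "fwd_cball X d x r \<subseteq> X" by (auto simp: mem_fwd_cball_iff)
  show "openin (fwd_topology X d) (X - fwd_cball X d x r)"
  proof (subst openin_subopen, intro ballI)
    fix y assume "y \<in> X - fwd_cball X d x r"
    then have y: "y \<in> X" "r < d x y" by (auto simp: mem_fwd_cball_iff)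
    have \<theta>: "1 \<le> \<theta>" using reversibility_ge_1[OF rev] .
    define s where "s = (d x y - r) / \<theta>"
    have s: "0 < s" "\<theta> * s = d x y - r" using y \<theta> by (auto simp: s_def)
    have "r < d x z" if z: "z \<in> X" "d y z < s" for z
    proof -
      have "d z y \<le> \<theta> * d y z"
        using reversibilityD[OF rev] z y M(1) by simp
      also have "\<dots> < \<theta> * s"
        using z \<theta> by simp
      finally show ?thesis
        using M(4)[OF x z(1) y(1)] s(2) by linarith
    qed
    then show "\<exists>T. openin (fwd_topology X d) T \<and> y \<in> T \<and> T \<subseteq> X - fwd_cball X d x r"
      using y s(1) openin_fwd_ball[OF y(1) s(1)] M(3)[OF y(1)]
      by (intro exI[of _ "fwd_ball X d y s"]) (force simp: fwd_ball_def fwd_cball_def)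
  qed
qed

lemma compact_theta_space_pointed_Theta_class:
  assumes X: "compact_theta_space \<theta> X d" and p: "p \<in> X" and \<Theta>: "\<And>r. 0 < r \<Longrightarrow> \<theta> \<le> \<Theta> r"
  shows "pointed_Theta_class \<Theta> X p d"
proof -
  have X': "irreversible_metric X d" "reversibility d X \<le> ereal \<theta>" "compact_space (fwd_topology X d)"
    using X unfolding compact_theta_space_def by auto
  have "reversibility d (fwd_cball X d p r) \<le> ereal (\<Theta> r)" if "0 < r" for r
  proof -
    have "reversibility d (fwd_cball X d p r) \<le> reversibility d X"
      by (rule reversibility_mono) (auto simp: mem_fwd_cball_iff)
    also have "\<dots> \<le> ereal \<theta>" by fact
    also have "\<dots> \<le> ereal (\<Theta> r)" using \<Theta>[OF that] by simp
    finally show ?thesis .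
  qed
  moreover have "compactin (fwd_topology X d) (fwd_cball X d x r)" if "x \<in> X" for x r
    using closedin_compact_space[OF X'(3) closedin_fwd_cball[OF X'(1,2) that]] .
  ultimately show ?thesis
    unfolding pointed_Theta_class_def pointed_fwd_Theta_space_def fwd_boundedly_compact_def
    using X'(1) p by blast
qed

text \<open>Sending each point to one at distance at most \<open>\<theta> * \<eta>\<close> in both
  directions changes distances by at most \<open>2 * \<theta> * \<eta>\<close>. Since the
  reversibility bound is global, one map serves all radii.\<close>

lemma theta_admissible_approximation:
  assumes D: "theta_admissible \<theta> A d1 B d2 D" and q: "q \<in> A" and p: "p \<in> B"
    and near: "\<And>x. x \<in> A \<Longrightarrow> \<exists>y\<in>B. D (Inr y) (Inl x) < \<eta>"
      "\<And>y. y \<in> B \<Longrightarrow> \<exists>x\<in>A. D (Inl x) (Inr y) < \<eta>"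
    and qp: "D (Inl q) (Inr p) < \<eta>" and \<epsilon>: "2 * \<theta> * \<eta> \<le> \<epsilon>"
  obtains f where "f \<in> A \<rightarrow> B" "f q = p" "\<And>r. distortion (fwd_cball A d1 q r) d1 d2 f \<le> ereal \<epsilon>"
    "\<And>r. fwd_cball B d2 p (r - \<epsilon>) \<subseteq> fwd_nbhd B d2 (f ` fwd_cball A d1 q r) \<epsilon>"
proof -
  have M: "irreversible_metric (A <+> B) D" and rev: "reversibility D (A <+> B) \<le> ereal \<theta>"
    and D1: "\<And>x y. x \<in> A \<Longrightarrow> y \<in> A \<Longrightarrow> d1 x y = D (Inl x) (Inl y)"
    and D2: "\<And>x y. x \<in> B \<Longrightarrow> y \<in> B \<Longrightarrow> d2 x y = D (Inr x) (Inr y)"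
    using D unfolding theta_admissible_def by auto
  note MD = irreversible_metricD[OF M]
  have \<theta>: "1 \<le> \<theta>" using reversibility_ge_1[OF rev] .
  have swap: "D u v \<le> \<theta> * \<eta> \<and> D v u \<le> \<theta> * \<eta>" if "u \<in> A <+> B" "v \<in> A <+> B" "D u v < \<eta>" for u v
  proof
    have "D v u \<le> \<theta> * D u v"
      using reversibilityD[OF rev that(2,1)] MD(1) that by simp
    also have "\<dots> \<le> \<theta> * \<eta>"
      using \<theta> that by (intro mult_left_mono) auto
    finally show "D v u \<le> \<theta> * \<eta>" .
    have "1 * D u v \<le> \<theta> * \<eta>"
      using \<theta> that MD(1)[of u v] by (intro mult_mono) auto
    then show "D u v \<le> \<theta> * \<eta>" by simp
  qed
  \<comment> \<open>The last clause forces the map chosen below to respect base points;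
    \<open>qp\<close> shows that \<open>p\<close> is a permitted partner of
    \<open>q\<close>.\<close>
  have "\<forall>x\<in>A. \<exists>y\<in>B. D (Inr y) (Inl x) \<le> \<theta> * \<eta> \<and> D (Inl x) (Inr y) \<le> \<theta> * \<eta> \<and> (x = q \<longrightarrow> y = p)"
  proof
    fix x assume x: "x \<in> A"
    show "\<exists>y\<in>B. D (Inr y) (Inl x) \<le> \<theta> * \<eta> \<and> D (Inl x) (Inr y) \<le> \<theta> * \<eta> \<and> (x = q \<longrightarrow> y = p)"
    proof (cases "x = q")
      case True
      then show ?thesis using swap[of "Inl q" "Inr p"] qp p q by (intro bexI[of _ p]) auto
    next
      case False
      obtain y where "y \<in> B" "D (Inr y) (Inl x) < \<eta>" using near(1)[OF x] by blast
      then show ?thesis using swap[of "Inr y" "Inl x"] x False by (intro bexI[of _ y]) auto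
    qed
  qed
  then obtain f where f: "\<And>x. x \<in> A \<Longrightarrow> f x \<in> B \<and> D (Inr (f x)) (Inl x) \<le> \<theta> * \<eta> \<and>
      D (Inl x) (Inr (f x)) \<le> \<theta> * \<eta> \<and> (x = q \<longrightarrow> f x = p)"
    by metis
  have dis: "\<bar>d2 (f x) (f y) - d1 x y\<bar> \<le> \<epsilon>" if "x \<in> A" "y \<in> A" for x y
  proof -
    have fxy: "f x \<in> B" "f y \<in> B" using f that by auto
    have "D (Inr (f x)) (Inr (f y)) \<le> D (Inr (f x)) (Inl x) + (D (Inl x) (Inl y) + D (Inl y) (Inr (f y)))"
      using MD(4)[of "Inr (f x)" "Inl x" "Inr (f y)"] MD(4)[of "Inl x" "Inl y" "Inr (f y)"] that fxy by (simp add: InlI InrI)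
    moreover have "D (Inl x) (Inl y) \<le> D (Inl x) (Inr (f x)) + (D (Inr (f x)) (Inr (f y)) + D (Inr (f y)) (Inl y))"
      using MD(4)[of "Inl x" "Inr (f x)" "Inl y"] MD(4)[of "Inr (f x)" "Inr (f y)" "Inl y"] that fxy by (simp add: InlI InrI)
    ultimately show ?thesis
      using f[of x] f[of y] that \<epsilon> D1[of x y] D2[of "f x" "f y"] by (simp add: abs_le_iff)
  qed
  show ?thesis
  proof (rule that)
    show "f \<in> A \<rightarrow> B" "f q = p" using f q by auto
    show "distortion (fwd_cball A d1 q r) d1 d2 f \<le> ereal \<epsilon>" for r
      using dis by (simp add: distortion_le_iff mem_fwd_cball_iff)
    show "fwd_cball B d2 p (r - \<epsilon>) \<subseteq> fwd_nbhd B d2 (f ` fwd_cball A d1 q r) \<epsilon>" for r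
    proof
      fix y assume "y \<in> fwd_cball B d2 p (r - \<epsilon>)"
      then have y: "y \<in> B" "d2 p y \<le> r - \<epsilon>" by (auto simp: mem_fwd_cball_iff)
      obtain a where a: "a \<in> A" "D (Inl a) (Inr y) < \<eta>" using near(2)[OF y(1)] by blast
      have ya: "D (Inr y) (Inl a) \<le> \<theta> * \<eta>"
        using swap[of "Inl a" "Inr y"] a y by auto
      \<comment> \<open>The almost preimage \<open>a\<close> of \<open>y\<close> has to lie in the
        ball of radius \<open>r\<close>; the margin \<open>\<epsilon>\<close> in
        \<open>r - \<epsilon>\<close> pays for the two crossings from \<open>q\<close> to
        \<open>p\<close> and from \<open>y\<close> to \<open>a\<close>.\<close>
      have "D (Inl q) (Inl a) \<le> D (Inl q) (Inr p) + (D (Inr p) (Inr y) + D (Inr y) (Inl a))"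
        using MD(4)[of "Inl q" "Inr p" "Inl a"] MD(4)[of "Inr p" "Inr y" "Inl a"] a y p q by (simp add: InlI InrI)
      moreover have "\<eta> \<le> \<theta> * \<eta>"
        using \<theta> qp MD(1)[OF InlI[OF q] InrI[OF p]] by (simp add: mult_le_cancel_right1)
      ultimately have "d1 q a \<le> r"
        using qp ya y(2) D1[OF q a(1)] D2[OF p y(1)] \<epsilon> by auto
      moreover have "D (Inr (f a)) (Inr y) \<le> D (Inr (f a)) (Inl a) + D (Inl a) (Inr y)"
        using MD(4)[of "Inr (f a)" "Inl a" "Inr y"] a y f by (simp add: InlI InrI)
      then have "d2 (f a) y < \<epsilon>"
        using a f[OF a(1)] D2[of "f a" y] y(1) \<open>\<eta> \<le> \<theta> * \<eta>\<close> \<epsilon> by auto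
      ultimately show "y \<in> fwd_nbhd B d2 (f ` fwd_cball A d1 q r) \<epsilon>"
        using y(1) a(1) by (auto simp: mem_fwd_nbhd_iff mem_fwd_cball_iff)
    qed
  qed
qed

text \<open>The point \<open>p\<close> is arbitrary and \<open>ps i\<close> is chosen near it in an
  almost optimal admissible metric. The choice precedes \<open>\<Theta>\<close>, the radius and the
  tolerance, so the same base points work for all of them.\<close>

lemma theta_GH_converges_imp_fwd_GH_converges:
  assumes conv: "theta_GH_converges \<theta> Xs ds X d"
  obtains ps p where "\<And>i. ps i \<in> Xs i" "p \<in> X"
    "\<And>\<Theta>. (\<And>r. 0 < r \<Longrightarrow> \<theta> \<le> \<Theta> r) \<Longrightarrow> fwd_GH_converges \<Theta> Xs ps ds X p d"
proof -
  let ?t = "\<lambda>i. theta_GH_distance \<theta> (Xs i) (ds i) X d"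
  have ci: "compact_theta_space \<theta> (Xs i) (ds i)" for i
    using conv unfolding theta_GH_converges_def by blast
  have cX: "compact_theta_space \<theta> X d" and lim: "?t \<longlonglongrightarrow> 0"
    using conv unfolding theta_GH_converges_def by blast+
  obtain p where p: "p \<in> X"
    using cX unfolding compact_theta_space_def by blast
  define close where "close i q \<eta> D \<longleftrightarrow> theta_admissible \<theta> (Xs i) (ds i) X d D \<and>
      (\<forall>x\<in>Xs i. \<exists>y\<in>X. D (Inr y) (Inl x) < \<eta>) \<and> (\<forall>y\<in>X. \<exists>x\<in>Xs i. D (Inl x) (Inr y) < \<eta>) \<and>
      D (Inl q) (Inr p) < \<eta>" for i q \<eta> D
  \<comment> \<open>The infimum need not be attained, hence the vanishing slack
    \<open>1 / (Suc i)\<close>. At an index with infinite distance any point is taken; by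
    convergence there are only finitely many of these.\<close>
  have "\<exists>q\<in>Xs i. ?t i < \<infinity> \<longrightarrow> (\<exists>\<eta> D. 0 < \<eta> \<and> ereal \<eta> < ?t i + ereal (1 / (Suc i)) \<and> close i q \<eta> D)" for i
  proof (cases "?t i < \<infinity>")
    case True
    then have "?t i < ?t i + ereal (1 / (Suc i))"
      using theta_GH_distance_nonneg[of \<theta> "Xs i" "ds i" X d]
      by (cases "?t i") auto
    then obtain D \<eta> where D: "theta_admissible \<theta> (Xs i) (ds i) X d D"
        "0 < \<eta>" "ereal \<eta> < ?t i + ereal (1 / (Suc i))"
        "\<And>x. x \<in> Xs i \<Longrightarrow> \<exists>y\<in>X. D (Inr y) (Inl x) < \<eta>"
        "\<And>y. y \<in> X \<Longrightarrow> \<exists>x\<in>Xs i. D (Inl x) (Inr y) < \<eta>"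
      by (elim theta_GH_distance_lessE) blast
    then obtain q where "q \<in> Xs i" "D (Inl q) (Inr p) < \<eta>"
      using p by blast
    then show ?thesis
      using D unfolding close_def by blast
  next
    case False
    then show ?thesis
      using ci[of i] unfolding compact_theta_space_def by blast
  qed
  then obtain ps where ps: "\<And>i. ps i \<in> Xs i"
      "\<And>i. ?t i < \<infinity> \<Longrightarrow> \<exists>\<eta> D. 0 < \<eta> \<and> ereal \<eta> < ?t i + ereal (1 / (Suc i)) \<and> close i (ps i) \<eta> D"
    by metis
  show ?thesis
  proof (rule that)
    show "ps i \<in> Xs i" for i by (rule ps)
    show "p \<in> X" by (rule p)
    fix \<Theta> :: "real \<Rightarrow> real" assume \<Theta>: "\<And>r. 0 < r \<Longrightarrow> \<theta> \<le> \<Theta> r"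
    have \<theta>: "1 \<le> \<theta>"
      using cX reversibility_ge_1 unfolding compact_theta_space_def by blast
    have "\<exists>N. \<forall>i>N. \<exists>f \<in> fwd_cball (Xs i) (ds i) (ps i) r \<rightarrow> X. f (ps i) = p \<and>
        distortion (fwd_cball (Xs i) (ds i) (ps i) r) (ds i) d f \<le> ereal \<epsilon> \<and>
        fwd_cball X d p (r - \<epsilon>) \<subseteq> fwd_nbhd X d (f ` fwd_cball (Xs i) (ds i) (ps i) r) \<epsilon>"
      if \<epsilon>: "0 < \<epsilon>" for r \<epsilon>
    proof -
      \<comment> \<open>The distance and the slack will each be below \<open>s\<close>, so
        \<open>\<eta> < 2 * s\<close> and thus
        \<open>2 * \<theta> * \<eta> \<le> \<epsilon>\<close>.\<close>
      define s where "s = \<epsilon> / (4 * \<theta>)"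
      have s: "0 < s" "4 * \<theta> * s = \<epsilon>" using \<epsilon> \<theta> by (auto simp: s_def)
      have "eventually (\<lambda>i. ?t i < ereal s) sequentially"
        using order_tendstoD(2)[OF lim, of "ereal s"] s by simp
      moreover have "eventually (\<lambda>i. 1 / real (Suc i) < s) sequentially"
        using order_tendstoD(2)[OF LIMSEQ_inverse_real_of_nat s(1)] by (simp add: inverse_eq_divide)
      ultimately have "eventually (\<lambda>i. ?t i < ereal s \<and> 1 / real (Suc i) < s) sequentially"
        by (rule eventually_conj)
      then obtain N where N: "\<And>i. N \<le> i \<Longrightarrow> ?t i < ereal s \<and> 1 / real (Suc i) < s"
        unfolding eventually_sequentially by blast
      have "\<exists>f \<in> fwd_cball (Xs i) (ds i) (ps i) r \<rightarrow> X. f (ps i) = p \<and>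
        distortion (fwd_cball (Xs i) (ds i) (ps i) r) (ds i) d f \<le> ereal \<epsilon> \<and>
        fwd_cball X d p (r - \<epsilon>) \<subseteq> fwd_nbhd X d (f ` fwd_cball (Xs i) (ds i) (ps i) r) \<epsilon>"
        if "N < i" for i
      proof -
        have ti: "?t i < ereal s" "1 / real (Suc i) < s" using N[of i] that by auto
        then have "?t i < \<infinity>" using order.strict_trans by fastforce
        then obtain \<eta> D where D: "0 < \<eta>" "ereal \<eta> < ?t i + ereal (1 / (Suc i))" "close i (ps i) \<eta> D"
          using ps(2) by blast
        have "?t i + ereal (1 / (Suc i)) < ereal s + ereal s"
          using ti by (intro ereal_add_strict_mono2) auto
        then have "\<eta> < 2 * s"
          using D(2) by (metis ereal_less(5) less_ereal.simps(1) mult_2 order.strict_trans plus_ereal.simps(1))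
        then have "\<theta> * \<eta> \<le> \<theta> * (2 * s)"
          using \<theta> by (intro mult_left_mono) auto
        then have \<eta>\<epsilon>: "2 * \<theta> * \<eta> \<le> \<epsilon>" using s(2) by simp
        obtain f where "f \<in> Xs i \<rightarrow> X" "f (ps i) = p"
          "\<And>r. distortion (fwd_cball (Xs i) (ds i) (ps i) r) (ds i) d f \<le> ereal \<epsilon>"
          "\<And>r. fwd_cball X d p (r - \<epsilon>) \<subseteq> fwd_nbhd X d (f ` fwd_cball (Xs i) (ds i) (ps i) r) \<epsilon>"
          using D(3) theta_admissible_approximation[OF _ ps(1) p _ _ _ \<eta>\<epsilon>, of i "ds i" d D]
          unfolding close_def by metis
        then show ?thesis
          by (intro bexI[of _ f]) (auto simp: mem_fwd_cball_iff Pi_iff)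
      qed
      then show ?thesis by blast
    qed
    moreover have "pointed_Theta_class \<Theta> (Xs i) (ps i) (ds i)" for i
      using compact_theta_space_pointed_Theta_class[OF ci ps(1) \<Theta>] .
    moreover have "pointed_Theta_class \<Theta> X p d"
      using compact_theta_space_pointed_Theta_class[OF cX p \<Theta>] .
    ultimately show "fwd_GH_converges \<Theta> Xs ps ds X p d"
      unfolding fwd_GH_converges_def by blast
  qed
qed

theorem proposition3p24:
  fixes \<Theta> :: "real \<Rightarrow> real"
  assumes "reversibility_bound \<Theta>"
  shows
    "(\<forall>(Xs :: nat \<Rightarrow> 'a set) ps ds (X :: 'b set) p d (X' :: 'c set) p' d'.
        fwd_GH_converges \<Theta> Xs ps ds X p d \<and> fwd_GH_converges \<Theta> Xs ps ds X' p' d' \<longrightarrow>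
        pointed_isometric X p d X' p' d') \<and>
     (\<forall>(Xs :: nat \<Rightarrow> 'a set) ps ds (X :: 'b set) p d \<Theta>'.
        fwd_GH_converges \<Theta> Xs ps ds X p d \<and>
        reversibility_bound \<Theta>' \<and> (\<forall>r>0. \<Theta> r \<le> \<Theta>' r) \<longrightarrow>
        fwd_GH_converges \<Theta>' Xs ps ds X p d) \<and>
     (\<forall>(Xs :: nat \<Rightarrow> 'a set) ps ds (X :: 'b set) p d (D :: real) \<theta>.
        fwd_GH_converges \<Theta> Xs ps ds X p d \<and>
        0 < D \<and> (\<forall>i. Diam (Xs i) (ds i) \<le> ereal D) \<and> \<Theta> D \<le> \<theta> \<longrightarrow>
        theta_GH_converges \<theta> Xs ds X d) \<and>
     (\<forall>(Xs :: nat \<Rightarrow> 'a set) ds (X :: 'b set) d (\<theta> :: real).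
        1 \<le> \<theta> \<and> theta_GH_converges \<theta> Xs ds X d \<longrightarrow>
        (\<exists>ps p. (\<forall>i. ps i \<in> Xs i) \<and> p \<in> X \<and>
           (\<forall>\<Theta>'. reversibility_bound \<Theta>' \<and> (\<forall>r>0. \<theta> \<le> \<Theta>' r) \<longrightarrow>
              fwd_GH_converges \<Theta>' Xs ps ds X p d)))"
proof (intro conjI allI impI; elim conjE)
  fix Xs :: "nat \<Rightarrow> 'a set" and ps ds and X :: "'b set" and p d and X' :: "'c set" and p' d'
  assume "fwd_GH_converges \<Theta> Xs ps ds X p d" "fwd_GH_converges \<Theta> Xs ps ds X' p' d'"
  then show "pointed_isometric X p d X' p' d'"
    by (rule fwd_GH_limit_unique)
next
  fix Xs :: "nat \<Rightarrow> 'a set" and ps ds and X :: "'b set" and p d \<Theta>'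
  assume "fwd_GH_converges \<Theta> Xs ps ds X p d" "\<forall>r>0. \<Theta> r \<le> \<Theta>' r"
  then show "fwd_GH_converges \<Theta>' Xs ps ds X p d"
    by (blast intro: fwd_GH_converges_mono)
next
  fix Xs :: "nat \<Rightarrow> 'a set" and ps ds and X :: "'b set" and p d and D \<theta> :: real
  assume "fwd_GH_converges \<Theta> Xs ps ds X p d" "0 < D"
    "\<forall>i. Diam (Xs i) (ds i) \<le> ereal D" "\<Theta> D \<le> \<theta>"
  then show "theta_GH_converges \<theta> Xs ds X d"
    by (blast intro: fwd_GH_converges_imp_theta_GH_converges)
next
  fix Xs :: "nat \<Rightarrow> 'a set" and ds and X :: "'b set" and d and \<theta> :: real
  assume "theta_GH_converges \<theta> Xs ds X d"
  then obtain ps p where "\<And>i. ps i \<in> Xs i" "p \<in> X"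
    "\<And>\<Theta>. (\<And>r. 0 < r \<Longrightarrow> \<theta> \<le> \<Theta> r) \<Longrightarrow> fwd_GH_converges \<Theta> Xs ps ds X p d"
    using theta_GH_converges_imp_fwd_GH_converges by blast
  then show "\<exists>ps p. (\<forall>i. ps i \<in> Xs i) \<and> p \<in> X \<and>
      (\<forall>\<Theta>'. reversibility_bound \<Theta>' \<and> (\<forall>r>0. \<theta> \<le> \<Theta>' r) \<longrightarrow> fwd_GH_converges \<Theta>' Xs ps ds X p d)"
    by (intro exI[of _ ps] exI[of _ p]) blast
qed

end
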